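(* Let $V$ be a vertex algebra, $\varphi$ a locally finite automorphism of $V$, written $\varphi=\sigma e^{-2\pi\mathrm i\mathcal N}$ with $\sigma\in\mathrm{Aut}(V)$ semisimple, $\mathcal N\in\mathrm{Der}(V)$ locally nilpotent and $\sigma\mathcal N=\mathcal N\sigma$, and let $W$ be a $\varphi$-twisted $V$-module. Then the following commutator formulas hold on $W$. (1) For all $\alpha,\beta\in\mathbb C/\mathbb Z$, $a\in V_\alpha$, $b\in V_\beta$, $m\in\alpha$, $k\in\beta$: $$\bigl[a_{(m+\mathcal N)},b_{(k+\mathcal N)}\bigr]=\sum_{j=0}^\infty\Bigl(\Bigl(\binom{m+\mathcal N}{j}a\Bigr)_{(j)}b\Bigr)_{(m+k-j+\mathcal N)} .$$ (2) For all $\alpha\in\mathbb C/\mathbb Z$, $a\in V_\alpha$ and $b\in V$: $$\bigl[Y(a,z_1),Y(b,z_2)\bigr]=\sum_{j=0}^\infty Y\Bigl(\bigl(D_{z_2}^{(j)}\delta_{\alpha+\mathcal N}(z_1,z_2)\,a\bigr)_{(j)}b,\,z_2\Bigr).$$ (3) For all $\alpha\in\mathbb C/\mathbb Z$, $a\in V_\alpha$, $m\in\alpha$ and $b\in V$: $$\bigl[a_{(m+\mathcal N)},Y(b,z)\bigr]=\sum_{j=0}^\infty Y\Bigl(\Bigl(\binom{m+\mathcal N}{j}z^{m-j+\mathcal N}a\Bigr)_{(j)}b,\,z\Bigr).$$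
   Context: All vector spaces are over $\mathbb C$, $\mathrm i=\sqrt{-1}$; $x^{(k)}=x^k/k!$, in particular $D^{(k)}=D^k/k!$ for an operator $D$. $z,z_1,z_2,\dots$ are commuting formal variables, $\zeta,\zeta_1,\zeta_2,\dots$ are further formal variables (thought of as $\zeta=\log z$, $\zeta_i=\log z_i$), and $z_{ij}=z_i-z_j$. Put $D_z=\partial_z+z^{-1}\partial_\zeta$, $D_\zeta=z\partial_z+\partial_\zeta$, and similarly $D_{z_i},D_{\zeta_i}$. Logarithmic fields. For a vector space $W$ and $\alpha\in\mathbb C/\mathbb Z$, $W[\zeta][[z]]z^{-\alpha}$ is the space of formal series $\sum_{i\ge0}w_i(\zeta)z^{i-m}$ with $w_i(\zeta)\in W[\zeta]$, $m\in\alpha$. Let $\mathrm{LFie}_\alpha(W)=\mathrm{Hom}_{\mathbb C}(W,W[\zeta][[z]]z^{-\alpha})$ and $\mathrm{LFie}(W)=\bigoplus_{\alpha\in\mathbb C/\mathbb Z}\mathrm{LFie}_\alpha(W)$; its elements, written $a(z)$ or $a(\zeta,z)$, are called logarithmic fields. Two logarithmic fields $a,b$ are local if $z_{12}^N a(z_1)b(z_2)=z_{12}^N b(z_2)a(z_1)$ for some integer $N\ge0$. For local $a,b$ and $n\in\mathbb Z$, the $n$-th product is the logarithmic field given by $(a_{(n)}b)(z)v=D_{z_1}^{(N-1-n)}\bigl(z_{12}^N a(z_1)b(z_2)v\bigr)\big|_{z_1=z_2=z,\ \zeta_1=\zeta_2=\zeta}$ ($v\in W$) for $n\le N-1$, and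 $a_{(n)}b=0$ for $n\ge N$ (independent of the choice of $N$). A local collection is a set of logarithmic fields in which every pair is local. Twisted modules. $V$ is a vertex algebra with vacuum $\mathbf 1$ and products $a_{(n)}b$ ($n\in\mathbb Z$). $\mathrm{Aut}(V)$ (resp. $\mathrm{Der}(V)$) is the set of invertible linear maps preserving all $n$-th products (resp. linear maps that are derivations of all $n$-th products). For $\varphi\in\mathrm{Aut}(V)$, a $\varphi$-twisted $V$-module is a vector space $W$ with a linear map $Y\colon V\to\mathrm{LFie}(W)$, $a\mapsto Y(a,z)$, such that $Y(\mathbf 1)=I$ (identity operator), $Y(V)$ is a local collection, $Y(\varphi a,z)=e^{2\pi\mathrm iD_\zeta}Y(a,z)$, and $Y(a_{(n)}b,z)=Y(a,z)_{(n)}Y(b,z)$ for all $a,b\in V$, $n\in\mathbb Z$. Here $e^{2\pi\mathrm iD_\zeta}$ sends $\zeta\mapsto\zeta+2\pi\mathrm i$ and $z^\gamma\mapsto e^{2\pi\mathrm i\gamma}z^\gamma$. Local finiteness and modes. $\varphi$ is locally finite if every $a\in V$ lies in a finite-dimensional $\varphi$-invariant subspace; such an automorphism has a unique decomposition $\varphi=\sigma e^{-2\pi\mathrm i\mathcal N}$ with commuting semisimple $\sigma\in\mathrm{Aut}(V)$ and locally nilpotent $\mathcal N\in\mathrm{Der}(V)$. For $\alpha\in\mathbb C/\mathbb Z$, $V_\alpha=\{a\in V\mid\sigma a=e^{-2\pi\mathrm i\alpha}a\}$. Put $z^{m+\mathcal N}a=z^me^{\zeta\mathcal N}a$ (similarly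 with $z_i,\zeta_i$), and extend $Y$ and the $n$-th products of $V$ linearly over expressions in the formal variables. Set $X(a,z)=Y(e^{\zeta\mathcal N}a,z)$, which equals $Y(a,z)|_{\zeta=0}$. For $a\in V_\alpha$, $m\in\alpha$, the $(m+\mathcal N)$-th mode of $a$ is $a_{(m+\mathcal N)}=\mathrm{Res}_z\,z^mX(a,z)\in\mathrm{End}(W)$, where $\mathrm{Res}_z$ is the coefficient of $z^{-1}$. Also $\binom{m+\mathcal N}{j}=\frac1{j!}(m+\mathcal N)(m+\mathcal N-1)\cdots(m+\mathcal N-j+1)$ as an operator on $V$. Shifted delta function: $\delta_{\alpha+\mathcal N}(z_1,z_2)=\sum_{m\in\alpha}z_1^{-m-1-\mathcal N}z_2^{m+\mathcal N}=\sum_{m\in\alpha}z_1^{-m-1}z_2^{m}\,e^{(\zeta_2-\zeta_1)\mathcal N}$, so that $D_{z_2}^{(j)}\delta_{\alpha+\mathcal N}(z_1,z_2)a=\sum_{m\in\alpha}z_1^{-m-1-\mathcal N}z_2^{m-j+\mathcal N}\binom{m+\mathcal N}{j}a$. *)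

theory Defs
  imports Complex_Main "HOL-Library.Groups_Big_Fun" "HOL-Library.Function_Algebras"
begin

section \<open>Vertex algebras, automorphisms and derivations\<close>

text \<open>
  A complex vector space is a type of class \<open>ab_group_add\<close> with a scalar multiplication
  satisfying \<^locale>\<open>vector_space\<close>. The product \<open>a\<^sub>(\<^sub>n\<^sub>) b\<close> is written \<open>nprod a n b\<close>.
  All sums in the Borcherds identity are finite by \<open>truncation\<close>, so \<^const>\<open>Sum_any\<close> is
  the intended sum.
\<close>

locale vertex_algebra = vector_space scale
  for scale :: "complex \<Rightarrow> 'v::ab_group_add \<Rightarrow> 'v" +
  fixes vac :: 'v and nprod :: "'v \<Rightarrow> int \<Rightarrow> 'v \<Rightarrow> 'v"
  assumes prod_linear_left: "Vector_Spaces.linear scale scale (\<lambda>a. nprod a n b)"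
    and prod_linear_right: "Vector_Spaces.linear scale scale (\<lambda>b. nprod a n b)"
    and truncation: "\<exists>N. \<forall>n\<ge>N. nprod a n b = 0"
    and vac_left: "nprod vac n a = (if n = -1 then a else 0)"
    and vac_right: "nprod a (-1) vac = a"
    and vac_right_nonneg: "n \<ge> 0 \<Longrightarrow> nprod a n vac = 0"
    and borcherds:
      "Sum_any (\<lambda>j::nat. scale (of_int m gchoose j) (nprod (nprod a (n + int j) b) (m + k - int j) c))
       = Sum_any (\<lambda>j::nat. scale ((-1) ^ j * (of_int n gchoose j))
           (nprod a (m + n - int j) (nprod b (k + int j) c)
            - scale ((-1) powi n) (nprod b (n + k - int j) (nprod a (m + int j) c))))"

definition va_Aut ::
    "(complex \<Rightarrow> 'v::ab_group_add \<Rightarrow> 'v) \<Rightarrow> ('v \<Rightarrow> int \<Rightarrow> 'v \<Rightarrow> 'v) \<Rightarrow> ('v \<Rightarrow> 'v) set" where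
  "va_Aut scale nprod = {f. Vector_Spaces.linear scale scale f \<and> bij f \<and>
     (\<forall>a n b. f (nprod a n b) = nprod (f a) n (f b))}"

definition va_Der ::
    "(complex \<Rightarrow> 'v::ab_group_add \<Rightarrow> 'v) \<Rightarrow> ('v \<Rightarrow> int \<Rightarrow> 'v \<Rightarrow> 'v) \<Rightarrow> ('v \<Rightarrow> 'v) set" where
  "va_Der scale nprod = {d. Vector_Spaces.linear scale scale d \<and>
     (\<forall>a n b. d (nprod a n b) = nprod (d a) n b + nprod a n (d b))}"

definition locally_finite_op :: "(complex \<Rightarrow> 'v::ab_group_add \<Rightarrow> 'v) \<Rightarrow> ('v \<Rightarrow> 'v) \<Rightarrow> bool" where
  "locally_finite_op scale f \<longleftrightarrow>
     (\<forall>a. \<exists>B. finite B \<and> a \<in> module.span scale B \<and> f ` module.span scale B \<subseteq> module.span scale B)"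

text \<open>Over the complex numbers, semisimple means that the eigenvectors span the space.\<close>

definition semisimple_op :: "(complex \<Rightarrow> 'v::ab_group_add \<Rightarrow> 'v) \<Rightarrow> ('v \<Rightarrow> 'v) \<Rightarrow> bool" where
  "semisimple_op scale f \<longleftrightarrow> module.span scale {a. \<exists>c. f a = scale c a} = UNIV"

definition locally_nilpotent :: "('v::ab_group_add \<Rightarrow> 'v) \<Rightarrow> bool" where
  "locally_nilpotent f \<longleftrightarrow> (\<forall>a. \<exists>k. (f ^^ k) a = 0)"

text \<open>The operator \<open>exp (c T)\<close>, for locally nilpotent \<open>T\<close>.\<close>

definition exp_op ::
    "(complex \<Rightarrow> 'v::ab_group_add \<Rightarrow> 'v) \<Rightarrow> complex \<Rightarrow> ('v \<Rightarrow> 'v) \<Rightarrow> 'v \<Rightarrow> 'v" where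
  "exp_op scale c T a = Sum_any (\<lambda>k::nat. scale (c ^ k / fact k) ((T ^^ k) a))"

definition C_mod_Z :: "complex set set" where
  "C_mod_Z = UNIV // {(x, y). x - y \<in> \<int>}"

definition sigma_eigenspace ::
    "(complex \<Rightarrow> 'v::ab_group_add \<Rightarrow> 'v) \<Rightarrow> ('v \<Rightarrow> 'v) \<Rightarrow> complex set \<Rightarrow> 'v set" where
  "sigma_eigenspace scale \<sigma> \<alpha> = {a. \<forall>m\<in>\<alpha>. \<sigma> a = scale (exp (- 2 * of_real pi * \<i> * m)) a}"


section \<open>Formal series in \<open>z\<close> and \<open>\<zeta>\<close>\<close>

text \<open>
  A formal series is given by its coefficients: \<open>f e p\<close> is the coefficient of
  \<open>z\<^sup>e \<zeta>\<^sup>p\<close>. A series \<open>F\<close> in two pairs of variables is curried: \<open>F e\<^sub>1 p\<^sub>1 e\<^sub>2 p\<^sub>2\<close> is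
  the coefficient of \<open>z\<^sub>1\<close>, \<open>\<zeta>\<^sub>1\<close>, \<open>z\<^sub>2\<close>, \<open>\<zeta>\<^sub>2\<close> to these respective powers.
\<close>

type_synonym 'x lser = "complex \<Rightarrow> nat \<Rightarrow> 'x"
type_synonym 'w logop = "'w \<Rightarrow> 'w lser"

text \<open>The series \<open>W[\<zeta>][[z]] z\<^sup>-\<^sup>\<alpha>\<close>:\<close>

definition lser_shift :: "complex set \<Rightarrow> 'w::ab_group_add lser set" where
  "lser_shift \<alpha> = {f. (\<forall>e. finite {p. f e p \<noteq> 0}) \<and>
     (\<exists>m\<in>\<alpha>. \<forall>e p. f e p \<noteq> 0 \<longrightarrow> (\<exists>i::nat. e = of_nat i - m))}"

definition LFie_comp ::
    "(complex \<Rightarrow> 'w::ab_group_add \<Rightarrow> 'w) \<Rightarrow> complex set \<Rightarrow> 'w logop set" where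
  "LFie_comp scale \<alpha> = {a. (\<forall>e p. Vector_Spaces.linear scale scale (\<lambda>v. a v e p)) \<and>
     (\<forall>v. a v \<in> lser_shift \<alpha>)}"

definition LFie :: "(complex \<Rightarrow> 'w::ab_group_add \<Rightarrow> 'w) \<Rightarrow> 'w logop set" where
  "LFie scale = {a. \<exists>A f. finite A \<and> A \<subseteq> C_mod_Z \<and> (\<forall>\<alpha>\<in>A. f \<alpha> \<in> LFie_comp scale \<alpha>) \<and>
     a = (\<Sum>\<alpha>\<in>A. f \<alpha>)}"

text \<open>\<open>D\<^sub>z = \<partial>\<^sub>z + z\<^sup>-\<^sup>1 \<partial>\<^sub>\<zeta>\<close> and its divided powers, in one variable and in each of two variables:\<close>

definition Dz :: "(complex \<Rightarrow> 'x::ab_group_add \<Rightarrow> 'x) \<Rightarrow> 'x lser \<Rightarrow> 'x lser" where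
  "Dz scale f = (\<lambda>e p. scale (e + 1) (f (e + 1) p) + scale (of_nat (p + 1)) (f (e + 1) (p + 1)))"

definition Dz_div :: "(complex \<Rightarrow> 'x::ab_group_add \<Rightarrow> 'x) \<Rightarrow> nat \<Rightarrow> 'x lser \<Rightarrow> 'x lser" where
  "Dz_div scale k f = (\<lambda>e p. scale (1 / fact k) ((Dz scale ^^ k) f e p))"

definition Dz1_div :: "(complex \<Rightarrow> 'x::ab_group_add \<Rightarrow> 'x) \<Rightarrow> nat \<Rightarrow> 'x lser lser \<Rightarrow> 'x lser lser" where
  "Dz1_div scale k F = (\<lambda>e1 p1 e2 p2. Dz_div scale k (\<lambda>e p. F e p e2 p2) e1 p1)"

definition Dz2_div :: "(complex \<Rightarrow> 'x::ab_group_add \<Rightarrow> 'x) \<Rightarrow> nat \<Rightarrow> 'x lser lser \<Rightarrow> 'x lser lser" where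
  "Dz2_div scale k F = (\<lambda>e1 p1. Dz_div scale k (F e1 p1))"

text \<open>Multiplication by \<open>z\<^sub>1 - z\<^sub>2\<close>:\<close>

definition z12_mult :: "'x::ab_group_add lser lser \<Rightarrow> 'x lser lser" where
  "z12_mult F = (\<lambda>e1 p1 e2 p2. F (e1 - 1) p1 e2 p2 - F e1 p1 (e2 - 1) p2)"

text \<open>The restriction \<open>z\<^sub>1 = z\<^sub>2 = z\<close>, \<open>\<zeta>\<^sub>1 = \<zeta>\<^sub>2 = \<zeta>\<close>:\<close>

definition restrict_diag :: "'x::ab_group_add lser lser \<Rightarrow> 'x lser" where
  "restrict_diag F = (\<lambda>e p. \<Sum>p1\<le>p. Sum_any (\<lambda>e1. F e1 p1 (e - e1) (p - p1)))"

text \<open>\<open>exp (2 \<pi> \<i> D\<^sub>\<zeta>)\<close>: the substitution \<open>\<zeta> \<mapsto> \<zeta> + 2 \<pi> \<i>\<close>, \<open>z\<^sup>\<gamma> \<mapsto> exp (2 \<pi> \<i> \<gamma>) z\<^sup>\<gamma>\<close>.\<close>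

definition monodromy :: "(complex \<Rightarrow> 'x::ab_group_add \<Rightarrow> 'x) \<Rightarrow> 'x lser \<Rightarrow> 'x lser" where
  "monodromy scale f = (\<lambda>e p. scale (exp (2 * of_real pi * \<i> * e))
     (Sum_any (\<lambda>q. scale (of_nat (q choose p) * (2 * of_real pi * \<i>) ^ (q - p)) (f e q))))"


section \<open>Locality and products of logarithmic fields\<close>

text \<open>The series \<open>a(z\<^sub>1) b(z\<^sub>2) v\<close> and \<open>b(z\<^sub>2) a(z\<^sub>1) v\<close>:\<close>

definition comp12 :: "'w logop \<Rightarrow> 'w logop \<Rightarrow> 'w \<Rightarrow> 'w lser lser" where
  "comp12 a b v = (\<lambda>e1 p1 e2 p2. a (b v e2 p2) e1 p1)"

definition comp21 :: "'w logop \<Rightarrow> 'w logop \<Rightarrow> 'w \<Rightarrow> 'w lser lser" where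
  "comp21 b a v = (\<lambda>e1 p1 e2 p2. b (a v e1 p1) e2 p2)"

definition local_order :: "nat \<Rightarrow> 'w::ab_group_add logop \<Rightarrow> 'w logop \<Rightarrow> bool" where
  "local_order N a b \<longleftrightarrow>
     (\<forall>v. (z12_mult ^^ N) (comp12 a b v) = (z12_mult ^^ N) (comp21 b a v))"

definition local_pair :: "'w::ab_group_add logop \<Rightarrow> 'w logop \<Rightarrow> bool" where
  "local_pair a b \<longleftrightarrow> (\<exists>N. local_order N a b)"

definition local_collection ::
    "(complex \<Rightarrow> 'w::ab_group_add \<Rightarrow> 'w) \<Rightarrow> 'w logop set \<Rightarrow> bool" where
  "local_collection scale C \<longleftrightarrow> C \<subseteq> LFie scale \<and> (\<forall>a\<in>C. \<forall>b\<in>C. local_pair a b)"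

definition nth_prod_order ::
    "(complex \<Rightarrow> 'w::ab_group_add \<Rightarrow> 'w) \<Rightarrow> nat \<Rightarrow> 'w logop \<Rightarrow> int \<Rightarrow> 'w logop \<Rightarrow> 'w logop" where
  "nth_prod_order scale N a n b = (\<lambda>v.
     if n \<le> int N - 1
     then restrict_diag (Dz1_div scale (nat (int N - 1 - n)) ((z12_mult ^^ N) (comp12 a b v)))
     else 0)"

text \<open>The result does not depend on the order of locality used; we take the least one.\<close>

definition nth_prod ::
    "(complex \<Rightarrow> 'w::ab_group_add \<Rightarrow> 'w) \<Rightarrow> 'w logop \<Rightarrow> int \<Rightarrow> 'w logop \<Rightarrow> 'w logop" where
  "nth_prod scale a n b = nth_prod_order scale (LEAST N. local_order N a b) a n b"

definition identity_field :: "'w::ab_group_add logop" where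
  "identity_field v = (\<lambda>e p. if e = 0 \<and> p = 0 then v else 0)"


section \<open>Twisted modules and modes\<close>

definition twisted_module ::
    "(complex \<Rightarrow> 'v::ab_group_add \<Rightarrow> 'v) \<Rightarrow> 'v \<Rightarrow> ('v \<Rightarrow> int \<Rightarrow> 'v \<Rightarrow> 'v) \<Rightarrow> ('v \<Rightarrow> 'v) \<Rightarrow>
     (complex \<Rightarrow> 'w::ab_group_add \<Rightarrow> 'w) \<Rightarrow> ('v \<Rightarrow> 'w logop) \<Rightarrow> bool" where
  "twisted_module scaleV vac nprod \<phi> scaleW Y \<longleftrightarrow>
     vector_space scaleW \<and>
     (\<forall>a. Y a \<in> LFie scaleW) \<and>
     (\<forall>v e p. Vector_Spaces.linear scaleV scaleW (\<lambda>a. Y a v e p)) \<and>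
     Y vac = identity_field \<and>
     local_collection scaleW (range Y) \<and>
     (\<forall>a. Y (\<phi> a) = (\<lambda>v. monodromy scaleW (Y a v))) \<and>
     (\<forall>a n b. Y (nprod a n b) = nth_prod scaleW (Y a) n (Y b))"

text \<open>\<open>z\<^sup>m\<^sup>+\<^sup>T a = z\<^sup>m exp (\<zeta> T) a\<close> for locally nilpotent \<open>T\<close>:\<close>

definition zpow_op ::
    "(complex \<Rightarrow> 'v::ab_group_add \<Rightarrow> 'v) \<Rightarrow> ('v \<Rightarrow> 'v) \<Rightarrow> complex \<Rightarrow> 'v \<Rightarrow> 'v lser" where
  "zpow_op scale T m a = (\<lambda>e p. if e = m then scale (1 / fact p) ((T ^^ p) a) else 0)"

text \<open>The operator \<open>(m + T)(m + T - 1) \<cdots> (m + T - j + 1) / j!\<close>:\<close>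

primrec falling_op ::
    "(complex \<Rightarrow> 'v::ab_group_add \<Rightarrow> 'v) \<Rightarrow> ('v \<Rightarrow> 'v) \<Rightarrow> complex \<Rightarrow> nat \<Rightarrow> 'v \<Rightarrow> 'v" where
  "falling_op scale T m 0 a = a"
| "falling_op scale T m (Suc j) a =
     falling_op scale T m j (scale (m - of_nat j) a + T a)"

definition binom_op ::
    "(complex \<Rightarrow> 'v::ab_group_add \<Rightarrow> 'v) \<Rightarrow> ('v \<Rightarrow> 'v) \<Rightarrow> complex \<Rightarrow> nat \<Rightarrow> 'v \<Rightarrow> 'v" where
  "binom_op scale T m j a = scale (1 / fact j) (falling_op scale T m j a)"

text \<open>The extensions of the \<open>n\<close>-th products and of \<open>Y\<close> to a first argument \<open>f(z)\<close> that is a series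
  over \<open>V\<close>; the latter is \<open>Y(f(z), z) v\<close>, with the same variables \<open>z\<close>, \<open>\<zeta>\<close> in both places.\<close>

definition prod_ext :: "('v \<Rightarrow> int \<Rightarrow> 'v \<Rightarrow> 'v) \<Rightarrow> 'v lser \<Rightarrow> int \<Rightarrow> 'v \<Rightarrow> 'v lser" where
  "prod_ext nprod f n b = (\<lambda>e p. nprod (f e p) n b)"

definition Y_ext :: "('v \<Rightarrow> 'w::ab_group_add logop) \<Rightarrow> 'v lser \<Rightarrow> 'w logop" where
  "Y_ext Y f v = (\<lambda>e p. \<Sum>q\<le>p. Sum_any (\<lambda>d. Y (f d q) v (e - d) (p - q)))"

definition X_field ::
    "(complex \<Rightarrow> 'v::ab_group_add \<Rightarrow> 'v) \<Rightarrow> ('v \<Rightarrow> 'v) \<Rightarrow> ('v \<Rightarrow> 'w::ab_group_add logop) \<Rightarrow> 'v \<Rightarrow> 'w logop"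
  where "X_field scaleV T Y a = Y_ext Y (zpow_op scaleV T 0 a)"

text \<open>The mode \<open>a\<^sub>(\<^sub>m\<^sub>+\<^sub>T\<^sub>) = Res\<^sub>z z\<^sup>m X(a, z)\<close>. For a twisted module \<open>X(a, z)\<close> does not involve \<open>\<zeta>\<close>,
  so the residue is read off at \<open>\<zeta>\<^sup>0\<close>.\<close>

definition mode ::
    "(complex \<Rightarrow> 'v::ab_group_add \<Rightarrow> 'v) \<Rightarrow> ('v \<Rightarrow> 'v) \<Rightarrow> ('v \<Rightarrow> 'w::ab_group_add logop) \<Rightarrow>
     'v \<Rightarrow> complex \<Rightarrow> 'w \<Rightarrow> 'w" where
  "mode scaleV T Y a m v = X_field scaleV T Y a v (- m - 1) 0"

text \<open>\<open>\<delta>\<^sub>\<alpha>\<^sub>+\<^sub>T(z\<^sub>1, z\<^sub>2) a\<close>, the sum over \<open>m \<in> \<alpha>\<close> of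
  \<open>z\<^sub>1\<^sup>-\<^sup>m\<^sup>-\<^sup>1\<^sup>-\<^sup>T z\<^sub>2\<^sup>m\<^sup>+\<^sup>T a\<close>. At most one \<open>m\<close> contributes to each coefficient.\<close>

definition delta_op ::
    "(complex \<Rightarrow> 'v::ab_group_add \<Rightarrow> 'v) \<Rightarrow> ('v \<Rightarrow> 'v) \<Rightarrow> complex set \<Rightarrow> 'v \<Rightarrow> 'v lser lser" where
  "delta_op scale T \<alpha> a = (\<lambda>e1 p1 e2 p2. Sum_any (\<lambda>m. if m \<in> \<alpha>
     then zpow_op scale (\<lambda>x. - T x) (- m - 1) (zpow_op scale T m a e2 p2) e1 p1 else 0))"

definition commutator :: "('w::ab_group_add \<Rightarrow> 'w) \<Rightarrow> ('w \<Rightarrow> 'w) \<Rightarrow> 'w \<Rightarrow> 'w" where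
  "commutator A B = (\<lambda>v. A (B v) - B (A v))"

text \<open>A sum over all \<open>j \<ge> 0\<close> with only finitely many nonzero terms, whose value is \<open>s\<close>.
  For terms that are maps, the zero and the addition are pointwise.\<close>

definition has_finite_sum :: "(nat \<Rightarrow> 'x::comm_monoid_add) \<Rightarrow> 'x \<Rightarrow> bool" where
  "has_finite_sum f s \<longleftrightarrow> finite {j. f j \<noteq> 0} \<and> Sum_any f = s"

end

theory Submission
  imports Defs
begin

text \<open>
  Everything follows from the formula for \<open>[a\<^bsub>(m+\<N>)\<^esub>, Y(b, z)]\<close>. The formula for two modes is its
  coefficient at \<open>z\<^bsup>-k-1\<^esup> \<zeta>\<^sup>0\<close>, and the formula for two fields has it, applied to \<open>(-\<N>)\<^bsup>p\<^esup> a / p!\<close>, as its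
  coefficients in \<open>z\<^sub>1\<close> and \<open>\<zeta>\<^sub>1\<close>.

  The monodromy condition is first solved. For \<open>a \<in> V\<^sub>\<alpha>\<close> a coefficient of \<open>Y(e\<^bsup>\<zeta>\<N>\<^esup> a, z)\<close> is a polynomial in
  \<open>\<zeta>\<close> that is multiplied by a constant under \<open>\<zeta> \<mapsto> \<zeta> + 2\<pi>\<i>\<close>, hence is itself constant, and it vanishes unless
  the exponent of \<open>z\<close> lies in \<open>-\<alpha>\<close> (\<open>monodromy_rigidity\<close>, \<open>twisted_log_component\<close>). So \<open>\<partial>\<^sub>\<zeta>\<close> acts on \<open>Y(a, z)\<close>
  as \<open>-\<N>\<close> on \<open>a\<close>, and \<open>D\<^sub>z\<close> acts on the coefficient of \<open>z\<^sup>x\<close> as \<open>x - \<N>\<close>.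

  Let \<open>K = k + 1\<close> be an order of locality of \<open>Y(a, z)\<close> and \<open>Y(b, z)\<close>, and let
  \<open>H\<^sub>a = (z\<^sub>1 - z\<^sub>2)\<^bsup>K\<^esup> Y(a, z\<^sub>1) Y(b, z\<^sub>2) v\<close>, a series bounded below in both variables. The products
  \<open>Y(a, z\<^sub>1) Y(b, z\<^sub>2) v\<close> and \<open>Y(b, z\<^sub>2) Y(a, z\<^sub>1) v\<close> are the expansions of \<open>(z\<^sub>1 - z\<^sub>2)\<^bsup>-K\<^esup> H\<^sub>a\<close> in the two regions,
  so that a coefficient of \<open>[a\<^bsub>(m+\<N>)\<^esub>, Y(b, z)] v\<close> is a finite sum over integers \<open>n\<close> of \<open>n choose k\<close> times the
  coefficient of \<open>H\<^sub>a\<close> at \<open>z\<^sub>1\<^bsup>n-m\<^esup> \<zeta>\<^sub>1\<^sup>0\<close> (\<open>z12_jump\<close>). On the other side, \<open>Y(c\<^bsub>(j)\<^esub> b, z) v\<close> is the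
  restriction to the diagonal of \<open>D\<^bsup>(k-j)\<^esup> H\<^sub>c\<close>, which applies the binomial of \<open>x - \<N>\<close> over \<open>k - j\<close> to \<open>c\<close> at
  the exponent \<open>x = n - m\<close> (\<open>Y_prod_coeff\<close>). For \<open>c\<close> the binomial of \<open>m + \<N>\<close> over \<open>j\<close> applied to \<open>a\<close>, the
  Vandermonde identity for \<open>(x - \<N>) + (m + \<N>) = n\<close> sums this over \<open>j\<close> to the same \<open>n choose k\<close>
  (\<open>binom_op_vandermonde\<close>), and the factor \<open>e\<^bsup>\<zeta>\<N>\<^esup>\<close> in \<open>z\<^bsup>m-j+\<N>\<^esup> a\<close> removes the powers of \<open>\<zeta>\<^sub>1\<close>
  (\<open>cleared_log_resolution\<close>). The two sums agree term by term (\<open>commutator_coeff\<close>). The terms with \<open>j \<ge> K\<close>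
  vanish by the definition of the \<open>n\<close>-th product of fields, because that product does not depend on the order
  of locality (\<open>nth_prod_eq_order\<close>).
\<close>

section \<open>Binomials of an operator\<close>

locale vs_operator = vector_space scale
  for scale :: "complex \<Rightarrow> 'v::ab_group_add \<Rightarrow> 'v" +
  fixes T :: "'v \<Rightarrow> 'v"
  assumes T_linear: "Vector_Spaces.linear scale scale T"
begin

lemma T_add: "T (x + y) = T x + T y"
  and T_scale: "T (scale c x) = scale c (T x)"
  and T_zero [simp]: "T 0 = 0"
  using T_linear by (simp_all add: linear_iff_module_hom module_hom.add module_hom.scale
      module_hom.zero)

lemma neg_operator: "vs_operator scale (\<lambda>x. - T x)"
  by unfold_locales (simp_all add: T_add T_scale)

lemma falling_op_add: "falling_op scale T m j (x + y) = falling_op scale T m j x + falling_op scale T m j y"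
proof (induction j arbitrary: x y)
  case (Suc j)
  have "scale (m - of_nat j) (x + y) + T (x + y)
      = (scale (m - of_nat j) x + T x) + (scale (m - of_nat j) y + T y)"
    by (simp add: scale_right_distrib T_add)
  then show ?case by (simp only: falling_op.simps Suc.IH)
qed simp

lemma falling_op_scale: "falling_op scale T m j (scale c x) = scale c (falling_op scale T m j x)"
proof (induction j arbitrary: x)
  case (Suc j)
  have "scale (m - of_nat j) (scale c x) + T (scale c x) = scale c (scale (m - of_nat j) x + T x)"
    by (simp add: scale_right_distrib T_scale mult.commute)
  then show ?case by (simp only: falling_op.simps Suc.IH)
qed simp

lemma falling_op_T: "falling_op scale T m j (T x) = T (falling_op scale T m j x)"
proof (induction j arbitrary: x)
  case (Suc j)
  have "scale (m - of_nat j) (T x) + T (T x) = T (scale (m - of_nat j) x + T x)"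
    by (simp add: T_add T_scale)
  then show ?case by (simp only: falling_op.simps Suc.IH)
qed simp

lemma falling_op_Suc_outer:
  "falling_op scale T m (Suc j) x
    = scale (m - of_nat j) (falling_op scale T m j x) + T (falling_op scale T m j x)"
  by (simp add: falling_op_add falling_op_scale falling_op_T)

lemma binom_op_add: "binom_op scale T m j (x + y) = binom_op scale T m j x + binom_op scale T m j y"
  by (simp add: binom_op_def falling_op_add scale_right_distrib)

lemma binom_op_scale: "binom_op scale T m j (scale c x) = scale c (binom_op scale T m j x)"
  by (simp add: binom_op_def falling_op_scale mult.commute)

lemma binom_op_zero [simp]: "binom_op scale T m j 0 = 0"
  using binom_op_scale[of m j 0 0] by simp

lemma binom_op_T: "binom_op scale T m j (T x) = T (binom_op scale T m j x)"
  by (simp add: binom_op_def falling_op_T T_scale)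

lemma binom_op_0 [simp]: "binom_op scale T m 0 x = x"
  by (simp add: binom_op_def)

lemma binom_op_Suc:
  "scale (of_nat (Suc j)) (binom_op scale T m (Suc j) x)
    = binom_op scale T m j (scale (m - of_nat j) x + T x)"
  by (simp add: binom_op_def del: of_nat_Suc)

definition T_invariant :: "'v set \<Rightarrow> bool" where
  "T_invariant S \<longleftrightarrow> (\<forall>x\<in>S. \<forall>y\<in>S. x + y \<in> S) \<and> (\<forall>x\<in>S. \<forall>r. scale r x \<in> S) \<and> (\<forall>x\<in>S. T x \<in> S)"

lemma T_invariant_add: "T_invariant S \<Longrightarrow> x \<in> S \<Longrightarrow> y \<in> S \<Longrightarrow> x + y \<in> S"
  and T_invariant_scale: "T_invariant S \<Longrightarrow> x \<in> S \<Longrightarrow> scale r x \<in> S"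
  and T_invariant_T: "T_invariant S \<Longrightarrow> x \<in> S \<Longrightarrow> T x \<in> S"
  by (simp_all add: T_invariant_def)

lemma T_invariant_neg:
  assumes "T_invariant S" shows "vs_operator.T_invariant scale (\<lambda>x. - T x) S"
proof -
  interpret neg: vs_operator scale "\<lambda>x. - T x" by (rule neg_operator)
  have "- T x \<in> S" if "x \<in> S" for x
    using T_invariant_scale[OF assms T_invariant_T[OF assms that], of "-1"] by simp
  then show ?thesis
    using assms by (simp add: neg.T_invariant_def T_invariant_def)
qed

lemma T_invariant_pow: "T_invariant S \<Longrightarrow> x \<in> S \<Longrightarrow> (T ^^ k) x \<in> S"
  by (induction k) (simp_all add: T_invariant_T)

lemma T_invariant_falling_op: "T_invariant S \<Longrightarrow> x \<in> S \<Longrightarrow> falling_op scale T r k x \<in> S"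
  by (induction k arbitrary: x) (simp_all add: T_invariant_def)

lemma T_invariant_binom_op: "T_invariant S \<Longrightarrow> x \<in> S \<Longrightarrow> binom_op scale T r k x \<in> S"
  by (simp add: binom_op_def T_invariant_scale T_invariant_falling_op)

text \<open>The Vandermonde identity for the commuting operators \<open>x - T\<close> and \<open>m + T\<close>, whose sum is a scalar.
  In the induction, \<open>n + 1 = (n + 1 - j) + j\<close> splits the sum so that one of the two binomials loses
  its denominator; after that the new factors \<open>x - T - (n - j)\<close> and \<open>m + T - j\<close> add up to the scalar
  \<open>x + m - n\<close>.\<close>

lemma binom_op_vandermonde:
  "(\<Sum>j\<le>n. binom_op scale (\<lambda>x. - T x) x (n - j) (binom_op scale T m j c))
    = scale ((x + m) gchoose n) c"
proof (induction n arbitrary: c)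
  case 0
  interpret neg: vs_operator scale "\<lambda>x. - T x" by (rule neg_operator)
  show ?case by simp
next
  case (Suc n)
  interpret neg: vs_operator scale "\<lambda>x. - T x" by (rule neg_operator)
  define A where "A = binom_op scale (\<lambda>x. - T x) x"
  define B where "B = binom_op scale T m"
  have A_Suc: "scale (of_nat (Suc j)) (A (Suc j) y) = A j (scale (x - of_nat j) y - T y)" for j y
    using neg.binom_op_Suc[of j x y] by (simp add: A_def del: of_nat_Suc)
  have B_Suc: "scale (of_nat (Suc j)) (B (Suc j) y) = B j (scale (m - of_nat j) y + T y)" for j y
    using binom_op_Suc[of j m y] by (simp add: B_def del: of_nat_Suc)
  have A_scale: "A j (scale r y) = scale r (A j y)" for j r y
    by (simp add: A_def neg.binom_op_scale)
  have A_add: "A j (y + z) = A j y + A j z" for j y z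
    by (simp add: A_def neg.binom_op_add)
  have IH: "(\<Sum>j\<le>n. A (n - j) (B j c)) = scale ((x + m) gchoose n) c"
    using Suc.IH unfolding A_def B_def .
  have "scale (of_nat (Suc n)) (\<Sum>j\<le>Suc n. A (Suc n - j) (B j c))
      = (\<Sum>j\<le>Suc n. scale (of_nat (Suc n - j)) (A (Suc n - j) (B j c)))
        + (\<Sum>j\<le>Suc n. scale (of_nat j) (A (Suc n - j) (B j c)))"
    unfolding scale_sum_right sum.distrib[symmetric]
  proof (rule sum.cong[OF refl])
    fix j assume "j \<in> {..Suc n}"
    then have "(of_nat (Suc n) :: complex) = of_nat (Suc n - j) + of_nat j"
      by (simp flip: of_nat_add del: of_nat_Suc)
    then show "scale (of_nat (Suc n)) (A (Suc n - j) (B j c))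
      = scale (of_nat (Suc n - j)) (A (Suc n - j) (B j c)) + scale (of_nat j) (A (Suc n - j) (B j c))"
      by (simp only: scale_left_distrib)
  qed
  also have "(\<Sum>j\<le>Suc n. scale (of_nat (Suc n - j)) (A (Suc n - j) (B j c)))
      = (\<Sum>j\<le>n. A (n - j) (scale (x - of_nat (n - j)) (B j c) - T (B j c)))"
    by (simp add: Suc_diff_le A_Suc del: of_nat_Suc of_nat_diff)
  also have "(\<Sum>j\<le>Suc n. scale (of_nat j) (A (Suc n - j) (B j c)))
      = (\<Sum>j\<le>n. A (n - j) (scale (m - of_nat j) (B j c) + T (B j c)))"
  proof -
    have "scale (of_nat (Suc j)) (A (n - j) (B (Suc j) c))
        = A (n - j) (scale (m - of_nat j) (B j c) + T (B j c))" for j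
      unfolding A_scale[symmetric] B_Suc
      by (simp add: B_def binom_op_add binom_op_scale binom_op_T)
    then show ?thesis
      by (subst sum.atMost_Suc_shift) (simp del: of_nat_Suc)
  qed
  also have "(\<Sum>j\<le>n. A (n - j) (scale (x - of_nat (n - j)) (B j c) - T (B j c)))
      + (\<Sum>j\<le>n. A (n - j) (scale (m - of_nat j) (B j c) + T (B j c)))
      = (\<Sum>j\<le>n. scale (x + m - of_nat n) (A (n - j) (B j c)))"
    unfolding sum.distrib[symmetric]
  proof (rule sum.cong[OF refl])
    fix j assume "j \<in> {..n}"
    then have "(of_nat n :: complex) = of_nat (n - j) + of_nat j"
      by (simp flip: of_nat_add)
    then have eq: "x + m - of_nat n = (x - of_nat (n - j)) + (m - of_nat j)" by simp
    show "A (n - j) (scale (x - of_nat (n - j)) (B j c) - T (B j c))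
      + A (n - j) (scale (m - of_nat j) (B j c) + T (B j c)) = scale (x + m - of_nat n) (A (n - j) (B j c))"
      unfolding eq A_add[symmetric] A_scale[symmetric] by (simp add: scale_left_distrib[of _ _ "B j c"])
  qed
  also have "\<dots> = scale ((x + m - of_nat n) * ((x + m) gchoose n)) c"
    by (simp add: scale_sum_right[symmetric] IH)
  also have "(x + m - of_nat n) * ((x + m) gchoose n) = of_nat (Suc n) * ((x + m) gchoose Suc n)"
    by (metis gbinomial_absorb_comp gbinomial_absorption)
  also have "scale \<dots> c = scale (of_nat (Suc n)) (scale ((x + m) gchoose Suc n) c)"
    by simp
  finally have "scale (of_nat (Suc n)) (\<Sum>j\<le>Suc n. A (Suc n - j) (B j c))
      = scale (of_nat (Suc n)) (scale ((x + m) gchoose Suc n) c)" .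
  then show ?case
    unfolding A_def B_def by (simp only: scale_cancel_left of_nat_eq_0_iff) simp
qed

end

section \<open>Inverting multiplication by a power of the difference\<close>

lemma z12_mult_pow_Suc:
  "(z12_mult ^^ Suc k) F e1 p1 e2 p2
    = (z12_mult ^^ k) F (e1 - 1) p1 e2 p2 - (z12_mult ^^ k) F e1 p1 (e2 - 1) p2"
  by (simp add: z12_mult_def)

lemma z12_mult_pow_below1:
  assumes "\<And>e1 p1 e2 p2. Re e1 < B \<Longrightarrow> F e1 p1 e2 p2 = 0"
  shows "Re e1 < B \<Longrightarrow> (z12_mult ^^ k) F e1 p1 e2 p2 = 0"
  by (induction k arbitrary: e1 e2) (auto simp: assms z12_mult_pow_Suc simp del: funpow.simps(2))

lemma z12_mult_pow_below2:
  assumes "\<And>e1 p1 e2 p2. Re e2 < B \<Longrightarrow> F e1 p1 e2 p2 = 0"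
  shows "Re e2 < B \<Longrightarrow> (z12_mult ^^ k) F e1 p1 e2 p2 = 0"
  by (induction k arbitrary: e1 e2) (auto simp: assms z12_mult_pow_Suc simp del: funpow.simps(2))

text \<open>A series with \<open>z\<^sub>2\<close>-exponents bounded below is recovered from \<open>(z\<^sub>1 - z\<^sub>2)\<^bsup>k+1\<^esup> F\<close> by the expansion
  of \<open>(z\<^sub>1 - z\<^sub>2)\<^bsup>-k-1\<^esup>\<close> in nonnegative powers of \<open>z\<^sub>2\<close>, whose coefficients are the \<open>i choose k\<close>. The induction
  on \<open>k\<close> is summation by parts along the antidiagonal: the difference of \<open>i gchoose (k + 1)\<close> in \<open>i\<close> is
  \<open>i gchoose k\<close>, and the boundary term at \<open>M\<close> lies below the bound.\<close>

lemma z12_inverse_right: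
  fixes F :: "'w::ab_group_add lser lser" and scale :: "complex \<Rightarrow> 'w \<Rightarrow> 'w"
  assumes "vector_space scale"
    and F: "\<And>e1 p1 e2 p2. Re e2 < B \<Longrightarrow> F e1 p1 e2 p2 = 0"
    and M: "Re e2 + real k - real M < B"
  shows "(\<Sum>i<M. scale (of_nat i gchoose k)
      ((z12_mult ^^ Suc k) F (e1 + 1 + of_nat i) p1 (e2 + of_nat k - of_nat i) p2)) = F e1 p1 e2 p2"
  using M
proof (induction k)
  case 0
  have "(\<Sum>i<M. (z12_mult ^^ Suc 0) F (e1 + 1 + of_nat i) p1 (e2 - of_nat i) p2)
      = (\<Sum>i<M. F (e1 + of_nat i) p1 (e2 - of_nat i) p2 - F (e1 + of_nat (Suc i)) p1 (e2 - of_nat (Suc i)) p2)"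
    by (simp add: z12_mult_def algebra_simps)
  also have "\<dots> = F (e1 + of_nat 0) p1 (e2 - of_nat 0) p2 - F (e1 + of_nat M) p1 (e2 - of_nat M) p2"
    by (rule sum_lessThan_telescope')
  also have "F (e1 + of_nat M) p1 (e2 - of_nat M) p2 = 0"
    using 0 by (intro F) simp
  finally show ?case
    using assms(1) by (simp add: vector_space.vector_space_assms(4))
next
  case (Suc k)
  interpret vector_space scale by fact
  define u where "u = (z12_mult ^^ Suc k) F"
  define c where "c l i = ((of_nat i :: complex) gchoose l)" for l i :: nat
  let ?h = "\<lambda>i. u (e1 + of_nat i) p1 (e2 + of_nat (Suc k) - of_nat i) p2"
  have c_Suc: "c (Suc k) (Suc i) = c k i + c (Suc k) i" for i
    using gbinomial_Suc_Suc[of "of_nat i :: complex" k] by (simp add: c_def add.commute)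
  have c_0: "c (Suc k) 0 = 0"
    by (simp add: c_def gbinomial_0_left)
  have "(\<Sum>i<M. scale (of_nat i gchoose Suc k)
      ((z12_mult ^^ Suc (Suc k)) F (e1 + 1 + of_nat i) p1 (e2 + of_nat (Suc k) - of_nat i) p2))
    = (\<Sum>i<M. scale (c (Suc k) i) (?h i) - scale (c (Suc k) (Suc i)) (?h (Suc i))
        + scale (c k i) (?h (Suc i)))"
  proof (rule sum.cong[OF refl])
    fix i
    have "(z12_mult ^^ Suc (Suc k)) F (e1 + 1 + of_nat i) p1 (e2 + of_nat (Suc k) - of_nat i) p2
        = ?h i - ?h (Suc i)"
      unfolding z12_mult_pow_Suc[of "Suc k"] u_def by (simp add: algebra_simps)
    then show "scale (of_nat i gchoose Suc k)
        ((z12_mult ^^ Suc (Suc k)) F (e1 + 1 + of_nat i) p1 (e2 + of_nat (Suc k) - of_nat i) p2)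
      = scale (c (Suc k) i) (?h i) - scale (c (Suc k) (Suc i)) (?h (Suc i)) + scale (c k i) (?h (Suc i))"
      unfolding c_Suc by (simp add: c_def scale_right_diff_distrib scale_left_distrib)
  qed
  also have "\<dots> = (\<Sum>i<M. scale (c (Suc k) i) (?h i) - scale (c (Suc k) (Suc i)) (?h (Suc i)))
      + (\<Sum>i<M. scale (c k i) (?h (Suc i)))"
    by (rule sum.distrib)
  also have "(\<Sum>i<M. scale (c (Suc k) i) (?h i) - scale (c (Suc k) (Suc i)) (?h (Suc i)))
      = scale (c (Suc k) 0) (?h 0) - scale (c (Suc k) M) (?h M)"
    by (rule sum_lessThan_telescope')
  also have "?h M = 0"
    unfolding u_def by (rule z12_mult_pow_below2[where B = B]) (use F Suc.prems in auto)
  also have "(\<Sum>i<M. scale (c k i) (?h (Suc i))) = F e1 p1 e2 p2"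
    using Suc.IH Suc.prems by (simp add: c_def u_def algebra_simps)
  finally show ?case by (simp add: c_0)
qed

text \<open>The same for \<open>z\<^sub>1\<close>-exponents bounded below. The coefficients of the opposite expansion are, up to
  sign, the values of the same polynomial \<open>n gchoose k\<close> at the negative integers \<open>n = -1 - i\<close>; this is what
  lets the two expansions be combined in one sum over all integers.\<close>

lemma z12_inverse_left:
  fixes F :: "'w::ab_group_add lser lser" and scale :: "complex \<Rightarrow> 'w \<Rightarrow> 'w"
  assumes "vector_space scale"
    and F: "\<And>e1 p1 e2 p2. Re e1 < B \<Longrightarrow> F e1 p1 e2 p2 = 0"
    and M: "Re e1 - real M < B"
  shows "(\<Sum>i<M. scale ((- 1 - of_nat i) gchoose k)
      ((z12_mult ^^ Suc k) F (e1 - of_nat i) p1 (e2 + of_nat (Suc k) + of_nat i) p2)) = - F e1 p1 e2 p2"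
  using M
proof (induction k)
  case 0
  have "(\<Sum>i<M. (z12_mult ^^ Suc 0) F (e1 - of_nat i) p1 (e2 + 1 + of_nat i) p2)
      = (\<Sum>i<M. F (e1 - of_nat (Suc i)) p1 (e2 + of_nat (Suc i)) p2 - F (e1 - of_nat i) p1 (e2 + of_nat i) p2)"
    by (simp add: z12_mult_def algebra_simps)
  also have "\<dots> = F (e1 - of_nat M) p1 (e2 + of_nat M) p2 - F (e1 - of_nat 0) p1 (e2 + of_nat 0) p2"
    by (rule sum_lessThan_telescope)
  also have "F (e1 - of_nat M) p1 (e2 + of_nat M) p2 = 0"
    using 0 by (intro F) simp
  finally show ?case
    using assms(1) by (simp add: vector_space.vector_space_assms(4))
next
  case (Suc k)
  interpret vector_space scale by fact
  define u where "u = (z12_mult ^^ Suc k) F"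
  define c where "c l i = ((- of_nat i :: complex) gchoose l)" for l i :: nat
  let ?h = "\<lambda>i. u (e1 - of_nat i) p1 (e2 + of_nat (Suc k) + of_nat i) p2"
  have c_Suc: "c (Suc k) (Suc i) = c (Suc k) i - c k (Suc i)" for i
    using gbinomial_Suc_Suc[of "- of_nat (Suc i) :: complex" k] by (simp add: c_def)
  have c_0: "c (Suc k) 0 = 0"
    by (simp add: c_def gbinomial_0_left)
  have "(\<Sum>i<M. scale ((- 1 - of_nat i) gchoose Suc k)
      ((z12_mult ^^ Suc (Suc k)) F (e1 - of_nat i) p1 (e2 + of_nat (Suc (Suc k)) + of_nat i) p2))
    = (\<Sum>i<M. scale (c (Suc k) (Suc i)) (?h (Suc i)) - scale (c (Suc k) i) (?h i)
        + scale (c k (Suc i)) (?h i))"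
  proof (rule sum.cong[OF refl])
    fix i
    have "(z12_mult ^^ Suc (Suc k)) F (e1 - of_nat i) p1 (e2 + of_nat (Suc (Suc k)) + of_nat i) p2
        = ?h (Suc i) - ?h i"
      unfolding z12_mult_pow_Suc[of "Suc k"] u_def by (simp add: algebra_simps)
    moreover have "((- 1 - of_nat i) gchoose Suc k) = c (Suc k) (Suc i)"
      by (simp add: c_def)
    ultimately have "scale ((- 1 - of_nat i) gchoose Suc k)
        ((z12_mult ^^ Suc (Suc k)) F (e1 - of_nat i) p1 (e2 + of_nat (Suc (Suc k)) + of_nat i) p2)
      = scale (c (Suc k) (Suc i)) (?h (Suc i)) - scale (c (Suc k) (Suc i)) (?h i)"
      by (simp only: scale_right_diff_distrib)
    also have "scale (c (Suc k) (Suc i)) (?h i) = scale (c (Suc k) i) (?h i) - scale (c k (Suc i)) (?h i)"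
      unfolding c_Suc[of i] scale_left_diff_distrib ..
    finally show "scale ((- 1 - of_nat i) gchoose Suc k)
        ((z12_mult ^^ Suc (Suc k)) F (e1 - of_nat i) p1 (e2 + of_nat (Suc (Suc k)) + of_nat i) p2)
      = scale (c (Suc k) (Suc i)) (?h (Suc i)) - scale (c (Suc k) i) (?h i) + scale (c k (Suc i)) (?h i)"
      by simp
  qed
  also have "\<dots> = (\<Sum>i<M. scale (c (Suc k) (Suc i)) (?h (Suc i)) - scale (c (Suc k) i) (?h i))
      + (\<Sum>i<M. scale (c k (Suc i)) (?h i))"
    by (rule sum.distrib)
  also have "(\<Sum>i<M. scale (c (Suc k) (Suc i)) (?h (Suc i)) - scale (c (Suc k) i) (?h i))
      = scale (c (Suc k) M) (?h M) - scale (c (Suc k) 0) (?h 0)"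
    by (rule sum_lessThan_telescope)
  also have "?h M = 0"
    unfolding u_def by (rule z12_mult_pow_below1[where B = B]) (use F Suc.prems in auto)
  also have "(\<Sum>i<M. scale (c k (Suc i)) (?h i)) = - F e1 p1 e2 p2"
    using Suc.IH Suc.prems by (simp add: c_def u_def)
  finally show ?case by (simp add: c_0)
qed

text \<open>If \<open>F\<close> and \<open>G\<close> become equal after multiplication by \<open>(z\<^sub>1 - z\<^sub>2)\<^bsup>k+1\<^esup>\<close>, they are the two
  expansions of the same quotient, and the difference of the expansions of \<open>(z\<^sub>1 - z\<^sub>2)\<^bsup>-k-1\<^esup>\<close> is a
  derivative of the delta function. In coefficients this is a finite sum over \<open>n\<close>, and any window \<open>I\<close> that
  contains the support may be used.\<close>

lemma z12_jump:
  fixes F G :: "'w::ab_group_add lser lser" and scale :: "complex \<Rightarrow> 'w \<Rightarrow> 'w"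
  assumes vs: "vector_space scale"
    and F: "\<And>e1 p1 e2 p2. Re e2 < B2 \<Longrightarrow> F e1 p1 e2 p2 = 0"
    and G: "\<And>e1 p1 e2 p2. Re e1 < B1 \<Longrightarrow> G e1 p1 e2 p2 = 0"
    and eq: "(z12_mult ^^ Suc k) F = (z12_mult ^^ Suc k) G"
    and "finite I"
    and I: "\<And>n. (z12_mult ^^ Suc k) F (e1 + 1 + of_int n) p1 (e2 + of_nat k - of_int n) p2 \<noteq> 0
      \<Longrightarrow> n \<in> I"
  shows "F e1 p1 e2 p2 - G e1 p1 e2 p2 = (\<Sum>n\<in>I. scale (of_int n gchoose k)
      ((z12_mult ^^ Suc k) F (e1 + 1 + of_int n) p1 (e2 + of_nat k - of_int n) p2))"
proof -
  interpret vector_space scale by fact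
  define h where "h n = scale (of_int n gchoose k)
      ((z12_mult ^^ Suc k) F (e1 + 1 + of_int n) p1 (e2 + of_nat k - of_int n) p2)" for n :: int
  obtain D where D: "\<And>n. n \<in> I \<Longrightarrow> nat \<bar>n\<bar> < D"
    using finite_imageI[OF \<open>finite I\<close>, of "\<lambda>n. nat \<bar>n\<bar>"] unfolding finite_nat_set_iff_bounded by blast
  obtain M2' :: nat where "Re e2 + real k - B2 < real M2'"
    using reals_Archimedean2 by blast
  then obtain M2 where M2: "Re e2 + real k - B2 < real M2" "M2 \<ge> D"
    by (metis less_le_trans max.cobounded1 max.cobounded2 of_nat_mono)
  from M2(1) have "F e1 p1 e2 p2 = (\<Sum>i<M2. scale (of_nat i gchoose k)
      ((z12_mult ^^ Suc k) F (e1 + 1 + of_nat i) p1 (e2 + of_nat k - of_nat i) p2))"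
    by (intro z12_inverse_right[OF vs F, symmetric]) auto
  then have right: "F e1 p1 e2 p2 = (\<Sum>i<M2. h (int i))"
    by (simp add: h_def del: funpow.simps)
  obtain M1' :: nat where "Re e1 - B1 < real M1'"
    using reals_Archimedean2 by blast
  then obtain M1 where M1: "Re e1 - B1 < real M1" "M1 \<ge> D"
    by (metis less_le_trans max.cobounded1 max.cobounded2 of_nat_mono)
  from M1(1) have "- G e1 p1 e2 p2 = (\<Sum>i<M1. scale ((- 1 - of_nat i) gchoose k)
      ((z12_mult ^^ Suc k) G (e1 - of_nat i) p1 (e2 + of_nat (Suc k) + of_nat i) p2))"
    by (intro z12_inverse_left[OF vs G, symmetric]) auto
  also have "\<dots> = (\<Sum>i<M1. h (- 1 - int i))"
    unfolding eq[symmetric] h_def by (rule sum.cong) (simp_all add: algebra_simps del: funpow.simps)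
  finally have left: "- G e1 p1 e2 p2 = (\<Sum>i<M1. h (- 1 - int i))" .
  \<comment> \<open>\<open>M1\<close> and \<open>M2\<close> are taken at least \<open>D\<close>, so that the two half sums together exhaust \<open>I\<close>\<close>
  define P N where "P = int ` {..<M2}" and "N = (\<lambda>i. - 1 - int i) ` {..<M1}"
  have fin: "finite P" "finite N" and disj: "P \<inter> N = {}"
    by (auto simp: P_def N_def)
  have "F e1 p1 e2 p2 - G e1 p1 e2 p2 = F e1 p1 e2 p2 + (- G e1 p1 e2 p2)"
    by simp
  also have "\<dots> = sum h P + sum h N"
    unfolding right left P_def N_def by (subst (1 2) sum.reindex) (auto intro!: inj_onI)
  also have "\<dots> = sum h (P \<union> N)"
    by (rule sum.union_disjoint[symmetric]) (use fin disj in auto)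
  also have "\<dots> = sum h I"
  proof (rule sum.mono_neutral_right)
    show "I \<subseteq> P \<union> N"
    proof
      fix n assume "n \<in> I"
      then have "nat \<bar>n\<bar> < D" by (rule D)
      then show "n \<in> P \<union> N"
        using M1(2) M2(2) by (cases "n \<ge> 0")
          (auto simp: P_def N_def image_iff intro: bexI[of _ "nat n"] bexI[of _ "nat (- 1 - n)"])
    qed
  qed (use fin I in \<open>auto simp: h_def\<close>)
  finally show ?thesis unfolding h_def .
qed

section \<open>Finitely supported sums\<close>

lemma Sum_any_eq_sum:
  assumes "finite I" "inj_on h I" "\<And>x. g x \<noteq> 0 \<Longrightarrow> x \<in> h ` I"
  shows "Sum_any g = (\<Sum>n\<in>I. g (h n))"
  by (subst Sum_any.expand_superset[of "h ` I"]) (use assms in \<open>auto simp: sum.reindex\<close>)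

lemma Sum_any_single:
  assumes "\<And>x. g x \<noteq> 0 \<Longrightarrow> x = y"
  shows "Sum_any g = g y"
  by (subst Sum_any.expand_superset[of "{y}"]) (use assms in auto)

lemma sum_fun_apply: "(\<Sum>i\<in>A. f i) x = (\<Sum>i\<in>A. f i x)"
  by (induction A rule: infinite_finite_induct) auto

lemma support_lessThan:
  assumes "\<And>j. j \<ge> K \<Longrightarrow> f j = 0"
  shows "{j. f j \<noteq> 0} \<subseteq> {..<K :: nat}"
  using assms leI by blast

lemma has_finite_sum_lessThan:
  assumes "\<And>j. j \<ge> K \<Longrightarrow> f j = 0" "(\<Sum>j<K. f j) = s"
  shows "has_finite_sum f s"
proof -
  have "{j. f j \<noteq> 0} \<subseteq> {..<K}"
    by (rule support_lessThan) (rule assms(1))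
  then show ?thesis
    unfolding has_finite_sum_def using assms(2)
    by (auto simp: Sum_any.expand_superset[of "{..<K}"] intro: finite_subset)
qed

section \<open>Restriction to the diagonal\<close>

lemma Dz_pow_Suc:
  "(Dz scale ^^ Suc k) f e p
    = scale (e + 1) ((Dz scale ^^ k) f (e + 1) p) + scale (of_nat (Suc p)) ((Dz scale ^^ k) f (e + 1) (Suc p))"
  by (subst funpow.simps(2)) (simp add: Dz_def)

lemma Dz_pow_below:
  fixes scale :: "complex \<Rightarrow> 'x::ab_group_add \<Rightarrow> 'x"
  assumes "vector_space scale" "\<And>p. f (e + of_nat k) p = 0"
  shows "(Dz scale ^^ k) f e p = 0"
proof -
  interpret vector_space scale by fact
  show ?thesis
    using assms(2)
  proof (induction k arbitrary: e p)
    case (Suc k)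
    have "(Dz scale ^^ k) f (e + 1) q = 0" for q
      using Suc.prems by (intro Suc.IH) (simp add: add.assoc)
    then show ?case unfolding Dz_pow_Suc by simp
  qed simp
qed

text \<open>The Leibniz rule \<open>[D\<^sub>z\<^bsup>k\<^esup>, z] = k D\<^sub>z\<^bsup>k-1\<^esup>\<close> in the first variable; for \<open>k = 0\<close> the truncated \<open>k - 1\<close> is
  multiplied by zero.\<close>

lemma Dz_pow_z12_mult:
  fixes scale :: "complex \<Rightarrow> 'x::ab_group_add \<Rightarrow> 'x"
  assumes "vector_space scale"
  shows "(Dz scale ^^ k) (\<lambda>e p. z12_mult F e p e2 p2) e1 p1
    = (Dz scale ^^ k) (\<lambda>e p. F e p e2 p2) (e1 - 1) p1 - (Dz scale ^^ k) (\<lambda>e p. F e p (e2 - 1) p2) e1 p1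
      + scale (of_nat k) ((Dz scale ^^ (k - 1)) (\<lambda>e p. F e p e2 p2) e1 p1)"
proof -
  interpret vector_space scale by fact
  define D where "D k = (Dz scale ^^ k) (\<lambda>e p. F e p e2 p2)" for k
  define D' where "D' k = (Dz scale ^^ k) (\<lambda>e p. F e p (e2 - 1) p2)" for k
  define E where "E k = (Dz scale ^^ k) (\<lambda>e p. z12_mult F e p e2 p2)" for k
  have step: "E (Suc k) = Dz scale (E k)" "D (Suc k) = Dz scale (D k)" "D' (Suc k) = Dz scale (D' k)" for k
    by (simp_all add: E_def D_def D'_def)
  have "E k e1 p1 = D k (e1 - 1) p1 - D' k e1 p1 + scale (of_nat k) (D (k - 1) e1 p1)"
  proof (induction k arbitrary: e1 p1)
    case 0
    show ?case by (simp add: E_def D_def D'_def z12_mult_def)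
  next
    case (Suc k)
    have D_pred: "scale (of_nat k) (D k e1 p1) = scale (of_nat k) (Dz scale (D (k - 1)) e1 p1)"
      by (cases k) (simp_all add: step(2))
    show ?case
      unfolding step(1) Dz_def Suc.IH
      using D_pred by (simp add: step(2,3) Dz_def algebra_simps)
  qed
  then show ?thesis by (simp add: E_def D_def D'_def)
qed

text \<open>The condition under which the restriction to the diagonal is a sum of finitely many terms. It is
  uniform in \<open>p\<^sub>1\<close> because \<open>D\<^sub>z\<close> mixes the powers of \<open>\<zeta>\<^sub>1\<close>.\<close>

definition diag_finite :: "'x::zero lser lser \<Rightarrow> bool" where
  "diag_finite F \<longleftrightarrow> (\<forall>s p2. finite {e1. \<exists>p1. F e1 p1 (s - e1) p2 \<noteq> 0})"

lemma diag_finite_Dz1_div: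
  fixes scale :: "complex \<Rightarrow> 'x::ab_group_add \<Rightarrow> 'x"
  assumes "vector_space scale" "diag_finite F"
  shows "diag_finite (Dz1_div scale k F)"
  unfolding diag_finite_def
proof (intro allI)
  fix s p2
  interpret vector_space scale by fact
  let ?A = "{e1. \<exists>p1. F e1 p1 ((s + of_nat k) - e1) p2 \<noteq> 0}"
  have "{e1. \<exists>p1. Dz1_div scale k F e1 p1 (s - e1) p2 \<noteq> 0} \<subseteq> (\<lambda>e. e - of_nat k) ` ?A"
  proof safe
    fix e1 p1 assume "Dz1_div scale k F e1 p1 (s - e1) p2 \<noteq> 0"
    then have "(Dz scale ^^ k) (\<lambda>e p. F e p (s - e1) p2) e1 p1 \<noteq> 0"
      by (auto simp: Dz1_div_def Dz_div_def)
    then obtain p where "F (e1 + of_nat k) p (s - e1) p2 \<noteq> 0"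
      using Dz_pow_below[OF assms(1), of "\<lambda>e p. F e p (s - e1) p2"] by blast
    then show "e1 \<in> (\<lambda>e. e - of_nat k) ` ?A"
      by (intro image_eqI[of _ _ "e1 + of_nat k"]) (auto intro!: exI[of _ p])
  qed
  moreover have "finite ?A" using assms(2) by (simp add: diag_finite_def)
  ultimately show "finite {e1. \<exists>p1. Dz1_div scale k F e1 p1 (s - e1) p2 \<noteq> 0}"
    by (meson finite_imageI finite_subset)
qed

lemma diag_finite_z12_mult:
  assumes "diag_finite F" shows "diag_finite (z12_mult F)"
  unfolding diag_finite_def
proof (intro allI)
  fix s p2
  let ?A = "{e1. \<exists>p1. F e1 p1 ((s - 1) - e1) p2 \<noteq> 0}"
  have "{e1. \<exists>p1. z12_mult F e1 p1 (s - e1) p2 \<noteq> 0} \<subseteq> (\<lambda>e. e + 1) ` ?A \<union> ?A"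
  proof
    fix e1 assume "e1 \<in> {e1. \<exists>p1. z12_mult F e1 p1 (s - e1) p2 \<noteq> 0}"
    then obtain p1 where "z12_mult F e1 p1 (s - e1) p2 \<noteq> 0" by auto
    then have "F (e1 - 1) p1 ((s - 1) - (e1 - 1)) p2 \<noteq> 0 \<or> F e1 p1 ((s - 1) - e1) p2 \<noteq> 0"
      by (auto simp: z12_mult_def algebra_simps)
    then have "e1 - 1 \<in> ?A \<or> e1 \<in> ?A" by blast
    moreover have "e1 = (e1 - 1) + 1" by simp
    ultimately show "e1 \<in> (\<lambda>e. e + 1) ` ?A \<union> ?A"
      by (blast intro: image_eqI)
  qed
  moreover have "finite ?A" using assms by (simp add: diag_finite_def)
  ultimately show "finite {e1. \<exists>p1. z12_mult F e1 p1 (s - e1) p2 \<noteq> 0}"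
    by (meson finite_imageI finite_UnI finite_subset)
qed

lemma diag_finiteD:
  assumes "diag_finite F" shows "finite {e1. F e1 p1 (s - e1) p2 \<noteq> 0}"
  by (rule finite_subset[of _ "{e1. \<exists>p1. F e1 p1 (s - e1) p2 \<noteq> 0}"])
    (use assms in \<open>auto simp: diag_finite_def\<close>)

lemma Sum_any_reindex_shift:
  fixes g :: "complex \<Rightarrow> 'x::comm_monoid_add"
  shows "Sum_any (\<lambda>x. g (x - c)) = Sum_any g"
  by (rule Sum_any.reindex_cong[of "\<lambda>x. x - c", symmetric])
    (auto simp: bij_def inj_def intro!: surjI[of _ "\<lambda>x. x + c"])

lemma Sum_any_diff:
  fixes f g :: "'a \<Rightarrow> 'x::ab_group_add"
  assumes "finite {x. f x \<noteq> 0}" "finite {x. g x \<noteq> 0}"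
  shows "Sum_any (\<lambda>x. f x - g x) = Sum_any f - Sum_any g"
proof -
  have "Sum_any (\<lambda>x. f x - g x) = sum (\<lambda>x. f x - g x) ({x. f x \<noteq> 0} \<union> {x. g x \<noteq> 0})"
    by (rule Sum_any.expand_superset) (use assms in auto)
  also have "\<dots> = Sum_any f - Sum_any g"
    unfolding sum_subtractf
    by (subst (1 2) Sum_any.expand_superset[of "{x. f x \<noteq> 0} \<union> {x. g x \<noteq> 0}"]) (use assms in auto)
  finally show ?thesis .
qed

lemma restrict_diag_z12_mult:
  assumes "diag_finite F"
  shows "restrict_diag (z12_mult F) = 0"
proof (intro ext)
  fix e p
  have "Sum_any (\<lambda>e1. z12_mult F e1 p1 (e - e1) (p - p1)) = 0" for p1
  proof -
    let ?g = "\<lambda>e1. F e1 p1 ((e - 1) - e1) (p - p1)"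
    have "Sum_any (\<lambda>e1. z12_mult F e1 p1 (e - e1) (p - p1)) = Sum_any (\<lambda>e1. ?g (e1 - 1) - ?g e1)"
      by (simp add: z12_mult_def algebra_simps)
    also have "\<dots> = Sum_any (\<lambda>e1. ?g (e1 - 1)) - Sum_any ?g"
    proof (rule Sum_any_diff)
      show fin: "finite {x. ?g x \<noteq> 0}" by (rule diag_finiteD) fact
      have "{x. ?g (x - 1) \<noteq> 0} \<subseteq> (\<lambda>x. x + 1) ` {x. ?g x \<noteq> 0}"
        by (auto intro!: image_eqI[of _ _ "_ - 1"])
      then show "finite {x. ?g (x - 1) \<noteq> 0}" using fin by (meson finite_imageI finite_subset)
    qed
    finally show ?thesis using Sum_any_reindex_shift[of ?g 1] by simp
  qed
  then show "restrict_diag (z12_mult F) e p = 0 e p"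
    by (simp add: restrict_diag_def)
qed

lemma restrict_diag_add:
  assumes "diag_finite F" "diag_finite G"
  shows "restrict_diag (\<lambda>e1 p1 e2 p2. F e1 p1 e2 p2 + G e1 p1 e2 p2) = restrict_diag F + restrict_diag G"
  by (intro ext)
    (auto simp: restrict_diag_def sum.distrib[symmetric] intro!: sum.cong Sum_any.distrib diag_finiteD assms)

text \<open>By the Leibniz rule, up to a term \<open>z\<^sub>1 - z\<^sub>2\<close> times a series, which vanishes on the diagonal.
  This makes the \<open>n\<close>-th product independent of the order of locality with which it is computed.\<close>

lemma restrict_diag_Dz1_div_z12_mult:
  fixes scale :: "complex \<Rightarrow> 'x::ab_group_add \<Rightarrow> 'x"
  assumes vs: "vector_space scale" and fin: "diag_finite F"
  shows "restrict_diag (Dz1_div scale (Suc k) (z12_mult F)) = restrict_diag (Dz1_div scale k F)"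
proof -
  interpret vector_space scale by fact
  have "Dz1_div scale (Suc k) (z12_mult F)
      = (\<lambda>e1 p1 e2 p2. z12_mult (Dz1_div scale (Suc k) F) e1 p1 e2 p2 + Dz1_div scale k F e1 p1 e2 p2)"
    apply (intro ext)
    unfolding Dz1_div_def Dz_div_def Dz_pow_z12_mult[OF vs]
    unfolding z12_mult_def
    by (simp add: scale_right_distrib scale_right_diff_distrib divide_simps del: funpow.simps of_nat_Suc)
  moreover have "diag_finite (z12_mult (Dz1_div scale (Suc k) F))"
    by (intro diag_finite_z12_mult diag_finite_Dz1_div vs fin)
  ultimately show ?thesis
    by (simp add: restrict_diag_add restrict_diag_z12_mult diag_finite_Dz1_div[OF vs fin])
qed

lemma restrict_diag_Dz1_div_0:
  fixes scale :: "complex \<Rightarrow> 'x::ab_group_add \<Rightarrow> 'x"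
  assumes vs: "vector_space scale" and fin: "diag_finite F"
  shows "restrict_diag (Dz1_div scale 0 (z12_mult F)) = 0"
proof -
  have "Dz1_div scale 0 (z12_mult F) = z12_mult F"
    using vs by (simp add: Dz1_div_def Dz_div_def vector_space.vector_space_assms(4))
  then show ?thesis using restrict_diag_z12_mult[OF fin] by simp
qed

section \<open>Solutions of the monodromy equation\<close>

text \<open>In terms of the polynomial \<open>x(\<zeta>) = \<Sum> x\<^sub>p \<zeta>\<^sup>p\<close> the hypothesis reads \<open>x(\<zeta>) = c x(\<zeta> + \<tau>)\<close>. Comparing the
  two leading coefficients gives \<open>c = 1\<close>, and then the next ones exclude a positive degree.\<close>

lemma unipotent_shift_top:
  fixes x :: "nat \<Rightarrow> 'w::ab_group_add" and scale :: "complex \<Rightarrow> 'w \<Rightarrow> 'w"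
  assumes vs: "vector_space scale" and fin: "finite {q. x q \<noteq> 0}" and \<tau>: "\<tau> \<noteq> 0"
    and eq: "\<And>p. x p = scale c (Sum_any (\<lambda>q. scale (of_nat (q choose p) * \<tau> ^ (q - p)) (x q)))"
  shows "x p = 0 \<or> c = 1 \<and> p = 0"
proof (cases "\<forall>p. x p = 0")
  case False
  interpret vector_space scale by fact
  define P where "P = Max {q. x q \<noteq> 0}"
  have above: "x q = 0" if "q > P" for q
    using Max_ge[OF fin, of q] that by (auto simp: P_def)
  have top: "x P \<noteq> 0"
    using False fin Max_in[of "{q. x q \<noteq> 0}"] by (auto simp: P_def)
  have eq': "x p = scale c (\<Sum>q\<in>{p..P}. scale (of_nat (q choose p) * \<tau> ^ (q - p)) (x q))" for p
  proof -
    have "Sum_any (\<lambda>q. scale (of_nat (q choose p) * \<tau> ^ (q - p)) (x q))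
      = (\<Sum>q\<in>{p..P}. scale (of_nat (q choose p) * \<tau> ^ (q - p)) (x q))"
    proof (rule Sum_any.expand_superset)
      show "{q. scale (of_nat (q choose p) * \<tau> ^ (q - p)) (x q) \<noteq> 0} \<subseteq> {p..P}"
      proof
        fix q assume "q \<in> {q. scale (of_nat (q choose p) * \<tau> ^ (q - p)) (x q) \<noteq> 0}"
        then have "q choose p \<noteq> 0" "x q \<noteq> 0" by auto
        then have "p \<le> q" "q \<le> P"
          using above[of q] by (auto simp: binomial_eq_0_iff not_less intro: leI)
        then show "q \<in> {p..P}" by simp
      qed
    qed simp
    then show ?thesis using eq[of p] by simp
  qed
  have c: "c = 1"
  proof -
    have "scale c (x P) = scale 1 (x P)" using eq'[of P] by simp
    then show ?thesis using top by (simp only: scale_cancel_right) auto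
  qed
  have "P = 0"
  proof (rule ccontr)
    assume "P \<noteq> 0"
    then obtain Q where Q: "P = Suc Q" using not0_implies_Suc by blast
    have "{Q..P} = {Q, P}" by (auto simp: Q)
    then have "x Q = x Q + scale (of_nat P * \<tau>) (x P)"
      using eq'[of Q] by (simp add: c Q)
    then show False using top \<tau> \<open>P \<noteq> 0\<close> by simp
  qed
  then show ?thesis using above c by auto
qed simp

context vs_operator
begin

lemma T_pow_add: "(T ^^ i) (x + y) = (T ^^ i) x + (T ^^ i) y"
  by (induction i) (simp_all add: T_add)

lemma T_pow_scale: "(T ^^ i) (scale c x) = scale c ((T ^^ i) x)"
  by (induction i) (simp_all add: T_scale)

lemma neg_pow: "((\<lambda>x. - T x) ^^ i) x = scale ((-1) ^ i) ((T ^^ i) x)"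
  by (induction i) (simp_all add: T_scale)

lemma T_pow_zero [simp]: "(T ^^ i) 0 = 0"
  by (induction i) simp_all

lemma T_pow_eq_0:
  assumes "(T ^^ K) a = 0" "i \<ge> K" shows "(T ^^ i) a = 0"
  using assms funpow_add[of "i - K" K T] by (simp add: fun_eq_iff)

lemma exp_op_eq_sum:
  assumes "(T ^^ K) a = 0"
  shows "exp_op scale c T a = (\<Sum>k<K. scale (c ^ k / fact k) ((T ^^ k) a))"
proof -
  show ?thesis unfolding exp_op_def
  proof (rule Sum_any.expand_superset)
    show "{k. scale (c ^ k / fact k) ((T ^^ k) a) \<noteq> 0} \<subseteq> {..<K}"
      by (rule support_lessThan) (simp add: T_pow_eq_0[OF assms])
  qed simp
qed

end

lemma exp_2pi_eq_1_iff: "exp (2 * of_real pi * \<i> * z) = 1 \<longleftrightarrow> (\<exists>n::int. z = of_int n)"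
proof
  assume eq: "exp (2 * of_real pi * \<i> * z) = 1"
  have polar: "exp (2 * of_real pi * \<i> * z) = of_real (exp (- 2 * pi * Im z)) * cis (2 * pi * Re z)"
    by (subst exp_eq_polar) simp
  have "exp (- 2 * pi * Im z) = 1"
    using arg_cong[OF eq, of norm] unfolding polar by (simp add: norm_mult)
  then have Im: "Im z = 0" by simp
  then have "cis (2 * pi * Re z) = 1" using eq unfolding polar by simp
  then have "cos (2 * pi * Re z) = 1" by (metis cis.simps(1) one_complex.simps(1))
  then obtain n :: int where "2 * pi * Re z = of_int n * 2 * pi"
    by (auto simp: cos_one_2pi_int)
  then have "Re z = of_int n" by simp
  then show "\<exists>n::int. z = of_int n" using Im by (auto simp: complex_eq_iff)
next
  assume "\<exists>n::int. z = of_int n"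
  then obtain n :: int where "z = of_int n" ..
  then show "exp (2 * of_real pi * \<i> * z) = 1"
    by (subst exp_eq_polar) (simp add: cis_multiple_2pi)
qed

text \<open>The monodromy equation forces the dependence on \<open>\<zeta>\<close>: with \<open>y(a) = \<Sum> y(a, p) \<zeta>\<^sup>p\<close>, an identity
  \<open>y(e\<^bsup>-\<tau>T\<^esup> a)(\<zeta>) = c y(a)(\<zeta> + \<tau>)\<close> has only the solutions \<open>y(a)(\<zeta>) = y\<^sub>0(e\<^bsup>-\<zeta>T\<^esup> a)\<close> if \<open>c = 1\<close>, and only zero otherwise.
  By induction on the nilpotency index the formula holds for all \<open>T\<^bsup>i\<^esup> a\<close> with \<open>i > 0\<close>. The right-hand side
  solves the equation itself, so that its difference from \<open>y(a)\<close> is a polynomial that \<open>\<zeta> \<mapsto> \<zeta> + \<tau>\<close> multiplies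
  by \<open>c\<^sup>-\<^sup>1\<close>; it is zero, for \<open>c = 1\<close> because it has no constant term.\<close>

lemma (in vs_operator) monodromy_rigidity:
  fixes y :: "'v \<Rightarrow> nat \<Rightarrow> 'w::ab_group_add" and scaleW :: "complex \<Rightarrow> 'w \<Rightarrow> 'w"
  assumes y_linear: "\<And>p. Vector_Spaces.linear scale scaleW (\<lambda>a. y a p)"
    and fin: "\<And>a. finite {p. y a p \<noteq> 0}" and \<tau>: "\<tau> \<noteq> 0"
    and eq: "\<And>i p. y (exp_op scale (- \<tau>) T ((T ^^ i) a)) p
      = scaleW c (Sum_any (\<lambda>q. scaleW (of_nat (q choose p) * \<tau> ^ (q - p)) (y ((T ^^ i) a) q)))"
    and nil: "(T ^^ K) a = 0"
  shows "y a p = (if c = 1 then scaleW ((- 1) ^ p / fact p) (y ((T ^^ p) a) 0) else 0)"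
  using eq nil
proof (induction K arbitrary: a p)
  case 0
  interpret y: Vector_Spaces.linear scale scaleW "\<lambda>a. y a p" for p by (rule y_linear)
  have "(T ^^ p) 0 = 0" using T_pow_scale[of p 0 0] by simp
  then show ?case using 0 by (simp add: y.zero)
next
  case (Suc K a)
  interpret W: vector_space scaleW
    using y_linear by (simp add: Vector_Spaces.linear_iff)
  interpret y: Vector_Spaces.linear scale scaleW "\<lambda>a. y a p" for p by (rule y_linear)
  define S where "S x p = Sum_any (\<lambda>q. scaleW (of_nat (q choose p) * \<tau> ^ (q - p)) (x q))" for x :: "nat \<Rightarrow> 'w" and p
  define z where "z p = (if c = 1 then scaleW ((- 1) ^ p / fact p) (y ((T ^^ p) a) 0) else 0)" for p
  define r where "r p = y a p - z p" for p
  have z_above: "z p = 0" if "p \<ge> Suc K" for p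
    using T_pow_eq_0[OF Suc.prems(2) that] by (simp add: z_def y.zero)
  have z_fin: "finite {p. z p \<noteq> 0}"
    by (rule finite_subset[of _ "{..<Suc K}"]) (auto intro!: support_lessThan z_above)
  have S_fin: "finite {q. scaleW (of_nat (q choose p) * \<tau> ^ (q - p)) (x q) \<noteq> 0}"
    if "finite {q. x q \<noteq> 0}" for x p
    by (rule finite_subset[OF _ that]) auto
  have S_r: "S r p = S (y a) p - S z p" for p
    unfolding S_def r_def W.scale_right_diff_distrib
    by (intro Sum_any_diff S_fin fin z_fin)
  \<comment> \<open>the solution \<open>z\<close> itself satisfies the equation, term by term in \<open>q = p + i\<close>\<close>
  have z_eq: "(\<Sum>i<Suc K. scaleW ((- \<tau>) ^ i / fact i)
      (scaleW ((- 1) ^ p / fact p) (y ((T ^^ p) ((T ^^ i) a)) 0))) = S z p" if "c = 1" for p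
  proof -
    have "S z p = (\<Sum>i<Suc K. scaleW (of_nat ((p + i) choose p) * \<tau> ^ i) (z (p + i)))"
      unfolding S_def
    proof (subst Sum_any_eq_sum[of "{..<Suc K}" "\<lambda>i. p + i"])
      fix q assume "scaleW (of_nat (q choose p) * \<tau> ^ (q - p)) (z q) \<noteq> 0"
      then have "q choose p \<noteq> 0" "z q \<noteq> 0" by auto
      then have "p \<le> q" "q < Suc K"
        using z_above[of q] by (auto simp: binomial_eq_0_iff intro: leI)
      then show "q \<in> (\<lambda>i. p + i) ` {..<Suc K}" by (intro image_eqI[of _ _ "q - p"]) auto
    qed (auto intro: inj_onI)
    also have "\<dots> = (\<Sum>i<Suc K. scaleW ((- \<tau>) ^ i / fact i)
      (scaleW ((- 1) ^ p / fact p) (y ((T ^^ p) ((T ^^ i) a)) 0)))"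
    proof (rule sum.cong[OF refl])
      fix i
      have "(of_nat ((p + i) choose p) :: complex) = fact (p + i) / (fact p * fact i)"
        by (simp add: binomial_fact)
      then have "of_nat ((p + i) choose p) * \<tau> ^ i * ((- 1) ^ (p + i) / fact (p + i))
          = (- \<tau>) ^ i / fact i * ((- 1) ^ p / fact p)"
        by (simp add: power_add power_minus[of \<tau>] mult_ac)
      then show "scaleW (of_nat ((p + i) choose p) * \<tau> ^ i) (z (p + i)) = scaleW ((- \<tau>) ^ i / fact i)
          (scaleW ((- 1) ^ p / fact p) (y ((T ^^ p) ((T ^^ i) a)) 0))"
        using that by (simp add: z_def funpow_add)
    qed
    finally show ?thesis ..
  qed
  have expand: "(\<Sum>i<Suc K. scaleW ((- \<tau>) ^ i / fact i) (y ((T ^^ i) a) p)) = scaleW c (S (y a) p)" for p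
  proof -
    have "scaleW c (S (y a) p) = y (exp_op scale (- \<tau>) T a) p"
      using Suc.prems(1)[of 0 p] by (simp add: S_def)
    also have "\<dots> = (\<Sum>i<Suc K. scaleW ((- \<tau>) ^ i / fact i) (y ((T ^^ i) a) p))"
      by (simp only: exp_op_eq_sum[OF Suc.prems(2)] y.sum y.scale)
    finally show ?thesis ..
  qed
  have IH': "y ((T ^^ Suc i) a) p = (if c = 1 then scaleW ((- 1) ^ p / fact p) (y ((T ^^ p) ((T ^^ Suc i) a)) 0) else 0)" for i p
  proof (rule Suc.IH)
    show "(T ^^ K) ((T ^^ Suc i) a) = 0"
      using T_pow_eq_0[OF Suc.prems(2), of "K + Suc i"] by (simp only: funpow_add comp_apply)
    show "y (exp_op scale (- \<tau>) T ((T ^^ l) ((T ^^ Suc i) a))) p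
      = scaleW c (Sum_any (\<lambda>q. scaleW (of_nat (q choose p) * \<tau> ^ (q - p)) (y ((T ^^ l) ((T ^^ Suc i) a)) q)))" for l p
      using Suc.prems(1)[of "l + Suc i" p] by (simp only: funpow_add comp_apply)
  qed
  have r_eq: "r p = scaleW c (S r p)" for p
  proof (cases "c = 1")
    case True
    have "scaleW c (S (y a) p) - S z p = y a p - z p"
      unfolding expand[symmetric] z_eq[OF True, symmetric] sum_subtractf[symmetric]
      by (subst sum.lessThan_Suc_shift) (simp add: IH' True z_def del: funpow.simps(2))
    then show ?thesis using True by (simp add: S_r r_def)
  next
    case False
    have "scaleW c (S (y a) p) = y a p"
      unfolding expand[symmetric]
      by (subst sum.lessThan_Suc_shift) (simp add: IH' False del: funpow.simps(2))
    moreover have "z = (\<lambda>_. 0)" using False by (simp add: z_def fun_eq_iff)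
    ultimately show ?thesis by (simp add: S_r r_def) (simp add: S_def)
  qed
  have r_cases: "r p = 0 \<or> c = 1 \<and> p = 0" for p
  proof (rule unipotent_shift_top[OF W.vector_space_axioms _ \<tau>])
    show "finite {q. r q \<noteq> 0}"
      by (rule finite_subset[OF _ finite_UnI[OF fin[of a] z_fin]]) (auto simp: r_def)
    show "r p = scaleW c (Sum_any (\<lambda>q. scaleW (of_nat (q choose p) * \<tau> ^ (q - p)) (r q)))" for p
      using r_eq[of p] by (simp add: S_def)
  qed
  moreover have "r 0 = 0" if "c = 1" using that by (simp add: r_def z_def)
  ultimately have "r p = 0" for p using r_cases[of p] by auto
  then have "y a p = z p" for p by (simp add: r_def)
  then show ?case unfolding z_def .
qed

section \<open>Fields of one eigenvalue class\<close>

text \<open>What the commutator formulas need of a twisted module, for \<open>a\<close> in one \<open>\<sigma>\<close>-eigenspace \<open>U\<close>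
  and one representative \<open>m\<close> of its class: the assumptions \<open>Y_T\<close> and \<open>Y_coset\<close> say that
  \<open>Y(a, z) = X(e\<^bsup>-\<zeta>T\<^esup> a, z)\<close>, where \<open>X(a, z)\<close> involves only powers of \<open>z\<close> with exponent in \<open>-m + \<int>\<close>.
  Boundedness of exponents is expressed by real parts, because a general \<open>b\<close> has exponents in several
  classes.\<close>

locale log_component =
  V: vs_operator scaleV T + W: vector_space scaleW
  for scaleV :: "complex \<Rightarrow> 'v::ab_group_add \<Rightarrow> 'v" and T :: "'v \<Rightarrow> 'v"
    and scaleW :: "complex \<Rightarrow> 'w::ab_group_add \<Rightarrow> 'w" +
  fixes nprod :: "'v \<Rightarrow> int \<Rightarrow> 'v \<Rightarrow> 'v" and Y :: "'v \<Rightarrow> 'w logop"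
    and U :: "'v set" and m :: complex
  assumes Y_linear1: "Vector_Spaces.linear scaleV scaleW (\<lambda>a. Y a v e p)"
    and Y_linear2: "Vector_Spaces.linear scaleW scaleW (\<lambda>v. Y a v e p)"
    and Y_below: "\<exists>B. \<forall>e p. Re e < B \<longrightarrow> Y a v e p = 0"
    and Y_local: "local_pair (Y a) (Y b)"
    and Y_prod: "Y (nprod a n b) = nth_prod scaleW (Y a) n (Y b)"
    and nprod_zero: "nprod 0 n b = 0"
    and U: "V.T_invariant U"
    and Y_T: "c \<in> U \<Longrightarrow> Y (T c) v e p = scaleW (- of_nat (Suc p)) (Y c v e (Suc p))"
    and Y_coset: "c \<in> U \<Longrightarrow> Y c v e p \<noteq> 0 \<Longrightarrow> \<exists>n::int. e = of_int n - m"
begin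

sublocale neg: vs_operator scaleV "\<lambda>x. - T x"
  by (rule V.neg_operator)

sublocale Y1: Vector_Spaces.linear scaleV scaleW "\<lambda>a. Y a v e p" for v e p
  by (rule Y_linear1)

sublocale Y2: Vector_Spaces.linear scaleW scaleW "\<lambda>v. Y a v e p" for a e p
  by (rule Y_linear2)

lemmas U_T = V.T_invariant_T[OF U]

text \<open>The series \<open>(z\<^sub>1 - z\<^sub>2)\<^bsup>K\<^esup> Y(c, z\<^sub>1) Y(b, z\<^sub>2) v\<close>. When \<open>K\<close> is an order of locality, it is bounded below in
  both variables.\<close>

definition cleared :: "nat \<Rightarrow> 'v \<Rightarrow> 'v \<Rightarrow> 'w \<Rightarrow> 'w lser lser" where
  "cleared K c b v = (z12_mult ^^ K) (comp12 (Y c) (Y b) v)"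

lemma cleared_0: "cleared 0 c b v e1 p1 e2 p2 = Y c (Y b v e2 p2) e1 p1"
  by (simp add: cleared_def comp12_def)

lemma cleared_Suc: "cleared (Suc K) c b v e1 p1 e2 p2 = cleared K c b v (e1 - 1) p1 e2 p2 - cleared K c b v e1 p1 (e2 - 1) p2"
  unfolding cleared_def by (rule z12_mult_pow_Suc)

lemma cleared_add: "cleared K (c + d) b v e1 p1 e2 p2 = cleared K c b v e1 p1 e2 p2 + cleared K d b v e1 p1 e2 p2"
  by (induction K arbitrary: e1 e2) (simp_all add: cleared_0 cleared_Suc Y1.add)

lemma cleared_scale: "cleared K (scaleV r c) b v e1 p1 e2 p2 = scaleW r (cleared K c b v e1 p1 e2 p2)"
  by (induction K arbitrary: e1 e2) (simp_all add: cleared_0 cleared_Suc Y1.scale W.scale_right_diff_distrib)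

lemma cleared_zero [simp]: "cleared K 0 b v e1 p1 e2 p2 = 0"
  using cleared_scale[of K 0 0] by simp

lemma cleared_neg: "cleared K (- c) b v e1 p1 e2 p2 = - cleared K c b v e1 p1 e2 p2"
  using cleared_add[of K c "- c" b v e1 p1 e2 p2] by (simp add: eq_neg_iff_add_eq_0 add.commute)

lemma cleared_sum: "cleared K (\<Sum>i\<in>A. c i) b v e1 p1 e2 p2 = (\<Sum>i\<in>A. cleared K (c i) b v e1 p1 e2 p2)"
  by (induction A rule: infinite_finite_induct) (simp_all add: cleared_add)

lemma cleared_T:
  assumes "c \<in> U"
  shows "cleared K (T c) b v e1 p1 e2 p2 = scaleW (- of_nat (Suc p1)) (cleared K c b v e1 (Suc p1) e2 p2)"
  by (induction K arbitrary: e1 e2)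
    (simp_all add: cleared_0 cleared_Suc Y_T[OF assms] W.scale_right_diff_distrib del: of_nat_Suc)

lemma Y_log_coeff:
  assumes "c \<in> U"
  shows "Y c v e p = scaleW ((-1) ^ p / fact p) (Y ((T ^^ p) c) v e 0)"
  using assms
proof (induction p arbitrary: c)
  case (Suc p)
  have "Y ((T ^^ Suc p) c) v e 0 = Y ((T ^^ p) (T c)) v e 0"
    by (simp add: funpow_swap1)
  also have "scaleW ((-1) ^ p / fact p) \<dots> = scaleW (- of_nat (Suc p)) (Y c v e (Suc p))"
    using Suc.IH[of "T c"] Y_T[of c v e p] by (simp add: Suc.prems U_T)
  finally have "scaleW (- 1 / of_nat (Suc p)) (scaleW ((-1) ^ p / fact p) (Y ((T ^^ Suc p) c) v e 0))
      = scaleW (- 1 / of_nat (Suc p)) (scaleW (- of_nat (Suc p)) (Y c v e (Suc p)))"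
    by (simp only:)
  then show ?case by (simp del: of_nat_Suc funpow.simps add: mult.commute)
qed simp

lemma cleared_log_coeff:
  assumes "c \<in> U"
  shows "cleared K c b v e1 p1 e2 p2 = scaleW ((-1) ^ p1 / fact p1) (cleared K ((T ^^ p1) c) b v e1 0 e2 p2)"
proof (induction K arbitrary: e1 e2)
  case 0
  show ?case unfolding cleared_0 using assms by (rule Y_log_coeff)
next
  case (Suc K)
  show ?case unfolding cleared_Suc W.scale_right_diff_distrib by (simp only: Suc.IH[symmetric])
qed

lemma cleared_coset:
  assumes "c \<in> U" "cleared K c b v e1 p1 e2 p2 \<noteq> 0"
  shows "\<exists>n::int. e1 = of_int n - m"
  using assms(2)
proof (induction K arbitrary: e1 e2)
  case 0
  then show ?case using Y_coset[OF assms(1)] by (auto simp: cleared_0)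
next
  case (Suc K)
  then have "cleared K c b v (e1 - 1) p1 e2 p2 \<noteq> 0 \<or> cleared K c b v e1 p1 (e2 - 1) p2 \<noteq> 0"
    by (auto simp: cleared_Suc)
  then show ?case
  proof
    assume "cleared K c b v (e1 - 1) p1 e2 p2 \<noteq> 0"
    then obtain n :: int where "e1 - 1 = of_int n - m" using Suc.IH by blast
    then have "e1 = of_int (n + 1) - m" by (simp add: algebra_simps)
    then show ?thesis ..
  qed (use Suc.IH in blast)
qed

lemma cleared_below2:
  assumes "\<And>e p. Re e < B \<Longrightarrow> Y b v e p = 0" "Re e2 < B"
  shows "cleared K c b v e1 p1 e2 p2 = 0"
  unfolding cleared_def
  by (rule z12_mult_pow_below2[where B = B]) (use assms in \<open>auto simp: comp12_def Y2.zero\<close>)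

lemma cleared_below1:
  assumes "local_order K (Y c) (Y b)" "\<And>e p. Re e < B \<Longrightarrow> Y c v e p = 0" "Re e1 < B"
  shows "cleared K c b v e1 p1 e2 p2 = 0"
proof -
  have "cleared K c b v = (z12_mult ^^ K) (comp21 (Y b) (Y c) v)"
    using assms(1) by (simp add: cleared_def local_order_def)
  then show ?thesis
    by (simp only:) (rule z12_mult_pow_below1[where B = B], use assms in \<open>auto simp: comp21_def Y2.zero\<close>)
qed

text \<open>Since \<open>\<partial>\<^sub>\<zeta> Y(c, z) = - Y(T c, z)\<close>, the derivative \<open>D\<^sub>z = \<partial>\<^sub>z + z\<^sup>-\<^sup>1 \<partial>\<^sub>\<zeta>\<close> acts on the coefficient of \<open>z\<^sup>e\<close> as
  \<open>e - T\<close> inside the argument \<open>c\<close>. So every \<open>n\<close>-th product becomes a binomial operator applied to \<open>c\<close>.\<close>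

lemma Dz_pow_H:
  assumes "c \<in> U"
  shows "(Dz scaleW ^^ k) (\<lambda>e p. cleared K c b v e p e2 p2) e p
    = cleared K (falling_op scaleV (\<lambda>x. - T x) (e + of_nat k) k c) b v (e + of_nat k) p e2 p2"
proof (induction k arbitrary: e p)
  case 0
  show ?case by simp
next
  case (Suc k)
  define r where "r = e + of_nat (Suc k)"
  define d where "d = falling_op scaleV (\<lambda>x. - T x) r k c"
  have d: "d \<in> U"
    unfolding d_def using assms by (rule neg.T_invariant_falling_op[OF V.T_invariant_neg[OF U]])
  have r: "r = e + 1 + of_nat k" by (simp add: r_def)
  have "(Dz scaleW ^^ Suc k) (\<lambda>e p. cleared K c b v e p e2 p2) e p
      = scaleW (e + 1) (cleared K d b v r p e2 p2) + scaleW (of_nat (Suc p)) (cleared K d b v r (Suc p) e2 p2)"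
    unfolding Dz_pow_Suc Suc.IH d_def r ..
  also have "scaleW (of_nat (Suc p)) (cleared K d b v r (Suc p) e2 p2) = cleared K (- T d) b v r p e2 p2"
    by (simp add: cleared_neg cleared_T[OF d] del: of_nat_Suc)
  also have "scaleW (e + 1) (cleared K d b v r p e2 p2) + cleared K (- T d) b v r p e2 p2
      = cleared K (scaleV (r - of_nat k) d + (- T d)) b v r p e2 p2"
    by (simp only: r cleared_add cleared_scale) simp
  also have "scaleV (r - of_nat k) d + (- T d) = falling_op scaleV (\<lambda>x. - T x) r (Suc k) c"
    unfolding d_def by (rule neg.falling_op_Suc_outer[symmetric])
  finally show ?case by (simp only: r_def)
qed

lemma Dz1_div_H:
  assumes "c \<in> U"
  shows "Dz1_div scaleW k (cleared K c b v) e1 p1 e2 p2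
    = cleared K (binom_op scaleV (\<lambda>x. - T x) (e1 + of_nat k) k c) b v (e1 + of_nat k) p1 e2 p2"
  by (simp add: Dz1_div_def Dz_div_def Dz_pow_H[OF assms] binom_op_def cleared_scale)

lemma window:
  fixes B1 B2 :: real
  obtains I :: "int set" where "finite I"
    "\<And>n. \<lbrakk>Re (of_int n - m) \<ge> B1; Re (s - (of_int n - m)) \<ge> B2\<rbrakk> \<Longrightarrow> n \<in> I"
proof
  show "finite {\<lceil>B1 + Re m\<rceil>..\<lfloor>Re s + Re m - B2\<rfloor>}" by simp
qed (simp add: ceiling_le_iff le_floor_iff algebra_simps)

lemma cleared_diag_finite:
  assumes "c \<in> U" "local_order K (Y c) (Y b)"
  shows "diag_finite (cleared K c b v)"
  unfolding diag_finite_def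
proof (intro allI)
  fix s p2
  obtain B1 B2 where B: "\<And>e p. Re e < B1 \<Longrightarrow> Y c v e p = 0" "\<And>e p. Re e < B2 \<Longrightarrow> Y b v e p = 0"
    using Y_below by metis
  obtain I :: "int set" where I: "finite I"
    "\<And>n. \<lbrakk>Re (of_int n - m) \<ge> B1; Re (s - (of_int n - m)) \<ge> B2\<rbrakk> \<Longrightarrow> n \<in> I"
    using window by blast
  have "{e1. \<exists>p1. cleared K c b v e1 p1 (s - e1) p2 \<noteq> 0} \<subseteq> (\<lambda>n. of_int n - m) ` I"
  proof safe
    fix e1 p1 assume nz: "cleared K c b v e1 p1 (s - e1) p2 \<noteq> 0"
    then obtain n :: int where n: "e1 = of_int n - m" using cleared_coset[OF assms(1)] by blast
    have "n \<in> I"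
      using cleared_below1[OF assms(2) B(1)] cleared_below2[OF B(2)] nz unfolding n by (intro I(2)) (meson leI)+
    then show "e1 \<in> (\<lambda>n. of_int n - m) ` I" using n by blast
  qed
  then show "finite {e1. \<exists>p1. cleared K c b v e1 p1 (s - e1) p2 \<noteq> 0}"
    using I(1) by (meson finite_imageI finite_subset)
qed

lemma local_order_Suc: "local_order K x y \<Longrightarrow> local_order (Suc K) x y"
  by (simp add: local_order_def)

lemma nth_prod_order_Suc:
  assumes "c \<in> U" "local_order K (Y c) (Y b)"
  shows "nth_prod_order scaleW (Suc K) (Y c) n (Y b) = nth_prod_order scaleW K (Y c) n (Y b)"
proof
  fix v
  have powers: "(z12_mult ^^ Suc K) (comp12 (Y c) (Y b) v) = z12_mult (cleared K c b v)"
      "(z12_mult ^^ K) (comp12 (Y c) (Y b) v) = cleared K c b v"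
    by (simp_all add: cleared_def)
  note fin = cleared_diag_finite[OF assms, of v]
  consider "n > int K" | "n = int K" | "n < int K" by linarith
  then show "nth_prod_order scaleW (Suc K) (Y c) n (Y b) v = nth_prod_order scaleW K (Y c) n (Y b) v"
  proof cases
    case 2
    then show ?thesis
      unfolding nth_prod_order_def powers
      using restrict_diag_Dz1_div_0[OF W.vector_space_axioms fin] by simp
  next
    case 3
    then have "nat (int (Suc K) - 1 - n) = Suc (nat (int K - 1 - n))" by linarith
    then show ?thesis
      unfolding nth_prod_order_def powers
      using 3 by (simp only: restrict_diag_Dz1_div_z12_mult[OF W.vector_space_axioms fin]) simp
  qed (simp add: nth_prod_order_def)
qed

lemma nth_prod_eq_order:
  assumes "c \<in> U" "local_order K (Y c) (Y b)"
  shows "nth_prod scaleW (Y c) n (Y b) = nth_prod_order scaleW K (Y c) n (Y b)"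
proof -
  define L where "L = (LEAST N. local_order N (Y c) (Y b))"
  have L: "local_order L (Y c) (Y b)" and "L \<le> K"
    unfolding L_def using assms(2) by (rule LeastI, rule Least_le)
  have "local_order (L + i) (Y c) (Y b)
      \<and> nth_prod_order scaleW (L + i) (Y c) n (Y b) = nth_prod_order scaleW L (Y c) n (Y b)" for i
  proof (induction i)
    case 0 then show ?case using L by simp
  next
    case (Suc i)
    then show ?case
      using local_order_Suc[of "L + i" "Y c" "Y b"] nth_prod_order_Suc[OF assms(1), of "L + i" b n] by simp
  qed
  from this[of "K - L"] show ?thesis
    using \<open>L \<le> K\<close> by (simp add: nth_prod_def L_def)
qed

definition cleared_swap :: "nat \<Rightarrow> 'v \<Rightarrow> 'v \<Rightarrow> 'w \<Rightarrow> 'w lser lser" where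
  "cleared_swap K c b v = (z12_mult ^^ K) (comp21 (Y b) (Y c) v)"

lemma cleared_swap_0: "cleared_swap 0 c b v e1 p1 e2 p2 = Y b (Y c v e1 p1) e2 p2"
  by (simp add: cleared_swap_def comp21_def)

lemma cleared_swap_Suc: "cleared_swap (Suc K) c b v e1 p1 e2 p2 = cleared_swap K c b v (e1 - 1) p1 e2 p2 - cleared_swap K c b v e1 p1 (e2 - 1) p2"
  unfolding cleared_swap_def by (rule z12_mult_pow_Suc)

lemma cleared_swap_add: "cleared_swap K (c + d) b v e1 p1 e2 p2 = cleared_swap K c b v e1 p1 e2 p2 + cleared_swap K d b v e1 p1 e2 p2"
  by (induction K arbitrary: e1 e2) (simp_all add: cleared_swap_0 cleared_swap_Suc Y1.add Y2.add)

lemma cleared_swap_scale: "cleared_swap K (scaleV r c) b v e1 p1 e2 p2 = scaleW r (cleared_swap K c b v e1 p1 e2 p2)"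
  by (induction K arbitrary: e1 e2) (simp_all add: cleared_swap_0 cleared_swap_Suc Y1.scale Y2.scale W.scale_right_diff_distrib)

lemma cleared_swap_T:
  assumes "c \<in> U"
  shows "cleared_swap K (T c) b v e1 p1 e2 p2 = scaleW (- of_nat (Suc p1)) (cleared_swap K c b v e1 (Suc p1) e2 p2)"
  by (induction K arbitrary: e1 e2)
    (simp_all add: cleared_swap_0 cleared_swap_Suc Y_T[OF assms] Y2.scale Y2.neg W.scale_right_diff_distrib del: of_nat_Suc)

lemma local_order_iff:
  "local_order K (Y c) (Y b) \<longleftrightarrow> (\<forall>v e1 p1 e2 p2. cleared K c b v e1 p1 e2 p2 = cleared_swap K c b v e1 p1 e2 p2)"
  by (simp add: local_order_def cleared_def cleared_swap_def fun_eq_iff)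

lemma Y_local_Suc:
  obtains k where "local_order (Suc k) (Y a) (Y b)"
  using Y_local[of a b] local_order_Suc by (auto simp: local_pair_def)

text \<open>All operators \<open>f(T)\<close> are applied to \<open>a\<close> under the two conditions collected here, which they
  preserve: locality with \<open>b\<close> of a common order, and a common bound of the exponents on \<open>v\<close>.\<close>

definition admissible :: "nat \<Rightarrow> 'v \<Rightarrow> 'w \<Rightarrow> real \<Rightarrow> 'v set" where
  "admissible K b v B = {c \<in> U. local_order K (Y c) (Y b) \<and> (\<forall>e p. Re e < B \<longrightarrow> Y c v e p = 0)}"

lemma T_invariant_admissible: "V.T_invariant (admissible K b v B)"
  unfolding V.T_invariant_def admissible_def local_order_iff
  by (auto simp: V.T_invariant_add[OF U] V.T_invariant_scale[OF U] U_T cleared_add cleared_swap_add cleared_scale cleared_swap_scale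
      cleared_T cleared_swap_T Y1.add Y1.scale Y_T)

lemma Y_prod_zero:
  assumes "c \<in> U" "local_order K (Y c) (Y b)" "j \<ge> K"
  shows "Y (nprod c (int j) b) v e p = 0"
  using assms by (simp add: Y_prod nth_prod_eq_order nth_prod_order_def)

text \<open>The \<open>j\<close>-th product in coefficients, indexed so that the total degree \<open>s\<close> of the antidiagonal does not
  depend on \<open>j\<close>; this allows the products of all orders to be summed termwise in \<open>n\<close>.\<close>

lemma Y_prod_coeff:
  assumes c: "c \<in> admissible (Suc k) b v B" and "j \<le> k" and "finite I"
    and I: "\<And>d n p1 p2. \<lbrakk>d \<in> admissible (Suc k) b v B;
      cleared (Suc k) d b v (of_int n - m) p1 (s - (of_int n - m)) p2 \<noteq> 0\<rbrakk> \<Longrightarrow> n \<in> I"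
  shows "Y (nprod c (int j) b) v (s - of_nat (k - j)) p
    = (\<Sum>p1\<le>p. \<Sum>n\<in>I. cleared (Suc k) (binom_op scaleV (\<lambda>x. - T x) (of_int n - m) (k - j) c) b v
        (of_int n - m) p1 (s - (of_int n - m)) (p - p1))"
proof -
  have cU: "c \<in> U" and loc: "local_order (Suc k) (Y c) (Y b)"
    using c by (auto simp: admissible_def)
  let ?h = "\<lambda>n :: int. of_int n - m - of_nat (k - j)"
  have adm: "binom_op scaleV (\<lambda>x. - T x) x i c \<in> admissible (Suc k) b v B" for x i
    by (rule neg.T_invariant_binom_op[OF V.T_invariant_neg[OF T_invariant_admissible] c])
  have "Y (nprod c (int j) b) v (s - of_nat (k - j)) p
      = restrict_diag (Dz1_div scaleW (k - j) (cleared (Suc k) c b v)) (s - of_nat (k - j)) p"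
    using \<open>j \<le> k\<close> unfolding Y_prod nth_prod_eq_order[OF cU loc] nth_prod_order_def cleared_def
    by (simp add: nat_diff_distrib flip: of_nat_diff)
  also have "\<dots> = (\<Sum>p1\<le>p. \<Sum>n\<in>I. cleared (Suc k) (binom_op scaleV (\<lambda>x. - T x) (of_int n - m) (k - j) c) b v
        (of_int n - m) p1 (s - (of_int n - m)) (p - p1))"
    unfolding restrict_diag_def Dz1_div_H[OF cU]
  proof (rule sum.cong[OF refl])
    fix p1
    let ?g = "\<lambda>e1. cleared (Suc k) (binom_op scaleV (\<lambda>x. - T x) (e1 + of_nat (k - j)) (k - j) c) b v
        (e1 + of_nat (k - j)) p1 (s - of_nat (k - j) - e1) (p - p1)"
    have "Sum_any ?g = (\<Sum>n\<in>I. ?g (?h n))"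
    proof (rule Sum_any_eq_sum[OF \<open>finite I\<close>])
      show "inj_on ?h I" by (auto intro!: inj_onI)
      fix e1 assume nz: "?g e1 \<noteq> 0"
      then obtain n :: int where n: "e1 + of_nat (k - j) = of_int n - m"
        using cleared_coset[OF _ nz] adm by (auto simp: admissible_def)
      then have e1: "e1 = ?h n" by (simp add: algebra_simps)
      have "n \<in> I"
        using nz unfolding e1 by (intro I[OF adm]) (simp add: algebra_simps)
      then show "e1 \<in> ?h ` I" using e1 by blast
    qed
    then show "Sum_any ?g = (\<Sum>n\<in>I. cleared (Suc k) (binom_op scaleV (\<lambda>x. - T x) (of_int n - m) (k - j) c) b v
        (of_int n - m) p1 (s - (of_int n - m)) (p - p1))"
      by (simp add: algebra_simps)
  qed
  finally show ?thesis .
qed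

text \<open>The coefficients of \<open>e\<^bsup>-x\<^esup> e\<^bsup>x\<^esup> = 1\<close>.\<close>

lemma alternating_exp_sum:
  "(\<Sum>q\<le>r. (- 1) ^ (r - q) / (fact (r - q) * fact q)) = (if r = 0 then 1 else 0 :: complex)"
proof -
  have "(\<Sum>q\<le>r. (- 1) ^ (r - q) / (fact (r - q) * fact q))
      = (\<Sum>q\<le>r. of_nat (r choose q) * 1 ^ q * (- 1) ^ (r - q)) / (fact r :: complex)"
    unfolding sum_divide_distrib by (rule sum.cong) (auto simp: binomial_fact)
  also have "\<dots> = (1 + - 1) ^ r / fact r"
    by (simp only: binomial_ring)
  finally show ?thesis by (simp add: power_0_left)
qed

text \<open>The factor \<open>e\<^bsup>\<zeta>T\<^esup>\<close> from \<open>z\<^bsup>m-j+T\<^esup> a\<close> cancels the \<open>\<zeta>\<close>-dependence of \<open>Y(a, z)\<close>: on the diagonal \<open>\<zeta>\<^sub>1 = \<zeta>\<^sub>2 = \<zeta>\<close>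
  only the constant term in \<open>\<zeta>\<^sub>1\<close> survives.\<close>

lemma cleared_log_resolution:
  assumes "c \<in> U"
  shows "(\<Sum>q\<le>p. \<Sum>p1\<le>p - q. cleared K (scaleV (1 / fact q) ((T ^^ q) c)) b v x p1 y (p - q - p1))
    = cleared K c b v x 0 y p"
proof -
  define h where "h r = cleared K ((T ^^ r) c) b v x 0 y (p - r)" for r
  define g where "g q p1 = scaleW ((- 1) ^ p1 / (fact p1 * fact q)) (h (q + p1))" for q p1
  have term_eq: "cleared K (scaleV (1 / fact q) ((T ^^ q) c)) b v x p1 y (p - q - p1) = g q p1" for q p1
  proof -
    have "(T ^^ q) c \<in> U" using assms by (rule V.T_invariant_pow[OF U])
    then have "cleared K ((T ^^ q) c) b v x p1 y (p - q - p1)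
        = scaleW ((- 1) ^ p1 / fact p1) (cleared K ((T ^^ p1) ((T ^^ q) c)) b v x 0 y (p - q - p1))"
      by (rule cleared_log_coeff)
    also have "(T ^^ p1) ((T ^^ q) c) = (T ^^ (q + p1)) c"
      by (simp add: funpow_add add.commute[of q])
    finally show ?thesis
      by (simp add: cleared_scale g_def h_def mult.commute)
  qed
  have "(\<Sum>q\<le>p. \<Sum>p1\<le>p - q. g q p1) = (\<Sum>(q, p1)\<in>{(q, p1). q + p1 \<le> p}. g q p1)"
    by (subst sum.Sigma) (auto intro!: sum.cong)
  also have "\<dots> = (\<Sum>r\<le>p. \<Sum>q\<le>r. g q (r - q))"
    by (rule sum.triangle_reindex_eq)
  also have "\<dots> = (\<Sum>r\<le>p. scaleW (\<Sum>q\<le>r. (- 1) ^ (r - q) / (fact (r - q) * fact q)) (h r))"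
    by (simp add: g_def W.scale_sum_left)
  also have "\<dots> = (\<Sum>r\<le>p. if r = 0 then h 0 else 0)"
    by (rule sum.cong) (auto simp: alternating_exp_sum)
  also have "\<dots> = cleared K c b v x 0 y p"
    by (simp add: h_def)
  finally show ?thesis by (simp only: term_eq)
qed

text \<open>The right-hand side of the formula for \<open>[a\<^bsub>(m+T)\<^esub>, Y(b, z)]\<close> in coefficients, turned into the sum
  over \<open>n\<close> that describes the commutator. With exponent \<open>x = n - m\<close> of \<open>z\<^sub>1\<close>, the \<open>j\<close>-th product contributes
  \<open>(x - T) choose (k - j)\<close> and the formula contributes \<open>(m + T) choose j\<close>, so that the sum over \<open>j\<close> is the
  scalar \<open>n gchoose k\<close>.\<close>

lemma commutator_coeff:
  assumes "a \<in> U" "local_order (Suc k) (Y a) (Y b)"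
  shows "(\<Sum>j<Suc k. \<Sum>q\<le>p. Y (nprod (binom_op scaleV T m j (scaleV (1 / fact q) ((T ^^ q) a))) (int j) b) v
        (e - (m - of_nat j)) (p - q))
    = Y a (Y b v e p) (- m - 1) 0 - Y b (Y a v (- m - 1) 0) e p"
proof -
  obtain B1 B2 where B: "\<And>e p. Re e < B1 \<Longrightarrow> Y a v e p = 0" "\<And>e p. Re e < B2 \<Longrightarrow> Y b v e p = 0"
    using Y_below by metis
  define s where "s = e - m + of_nat k"
  obtain I :: "int set" where I: "finite I"
    "\<And>n. \<lbrakk>Re (of_int n - m) \<ge> B1; Re (s - (of_int n - m)) \<ge> B2\<rbrakk> \<Longrightarrow> n \<in> I"
    using window by blast
  have window: "n \<in> I" if "d \<in> admissible (Suc k) b v B1"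
    "cleared (Suc k) d b v (of_int n - m) p1 (s - (of_int n - m)) p2 \<noteq> 0" for d n p1 p2
  proof (rule I(2))
    show "B1 \<le> Re (of_int n - m)"
      using that cleared_below1[of "Suc k" d b B1 v] by (force simp: admissible_def intro: leI)
    show "B2 \<le> Re (s - (of_int n - m))"
      using that(2) cleared_below2[OF B(2)] by (meson leI)
  qed
  have a: "a \<in> admissible (Suc k) b v B1"
    using assms B(1) by (simp add: admissible_def)
  define c where "c q = scaleV (1 / fact q) ((T ^^ q) a)" for q
  have c: "c q \<in> admissible (Suc k) b v B1" for q
    unfolding c_def by (intro V.T_invariant_scale V.T_invariant_pow T_invariant_admissible a)
  define x where "x n = of_int n - m" for n :: int
  let ?A = "\<lambda>n j. binom_op scaleV (\<lambda>y. - T y) (x n) (k - j)"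
  have "(\<Sum>j<Suc k. \<Sum>q\<le>p. Y (nprod (binom_op scaleV T m j (c q)) (int j) b) v (e - (m - of_nat j)) (p - q))
    = (\<Sum>j\<le>k. \<Sum>q\<le>p. \<Sum>p1\<le>p - q. \<Sum>n\<in>I.
        cleared (Suc k) (?A n j (binom_op scaleV T m j (c q))) b v (x n) p1 (s - x n) (p - q - p1))"
    unfolding lessThan_Suc_atMost x_def
  proof (intro sum.cong refl)
    fix j q assume "j \<in> {..k}"
    then have e: "e - (m - of_nat j) = s - of_nat (k - j)" by (simp add: s_def of_nat_diff)
    show "Y (nprod (binom_op scaleV T m j (c q)) (int j) b) v (e - (m - of_nat j)) (p - q)
      = (\<Sum>p1\<le>p - q. \<Sum>n\<in>I. cleared (Suc k) (binom_op scaleV (\<lambda>y. - T y) (of_int n - m) (k - j)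
          (binom_op scaleV T m j (c q))) b v (of_int n - m) p1 (s - (of_int n - m)) (p - q - p1))"
      unfolding e
      by (rule Y_prod_coeff[OF V.T_invariant_binom_op[OF T_invariant_admissible c] _ I(1) window])
        (use \<open>j \<in> {..k}\<close> in auto)
  qed
  also have "\<dots> = (\<Sum>q\<le>p. \<Sum>p1\<le>p - q. \<Sum>n\<in>I. \<Sum>j\<le>k.
        cleared (Suc k) (?A n j (binom_op scaleV T m j (c q))) b v (x n) p1 (s - x n) (p - q - p1))"
    by (simp only: sum.swap[of _ "{..k}"])
  also have "\<dots> = (\<Sum>q\<le>p. \<Sum>p1\<le>p - q. \<Sum>n\<in>I. scaleW (of_int n gchoose k)
        (cleared (Suc k) (c q) b v (x n) p1 (s - x n) (p - q - p1)))"
    by (simp add: cleared_sum[symmetric] V.binom_op_vandermonde cleared_scale) (simp add: x_def)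
  also have "\<dots> = (\<Sum>n\<in>I. scaleW (of_int n gchoose k) (\<Sum>q\<le>p. \<Sum>p1\<le>p - q.
        cleared (Suc k) (c q) b v (x n) p1 (s - x n) (p - q - p1)))"
    by (simp only: W.scale_sum_right sum.swap[of _ _ I])
  also have "\<dots> = (\<Sum>n\<in>I. scaleW (of_int n gchoose k) (cleared (Suc k) a b v (x n) 0 (s - x n) p))"
    unfolding c_def cleared_log_resolution[OF assms(1)] ..
  also have "\<dots> = comp12 (Y a) (Y b) v (- m - 1) 0 e p - comp21 (Y b) (Y a) v (- m - 1) 0 e p"
  proof -
    have xs: "x n = - m - 1 + 1 + of_int n" "s - x n = e + of_nat k - of_int n" for n
      by (simp_all add: x_def s_def)
    show ?thesis
      unfolding xs(2) unfolding xs(1) cleared_def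
    proof (rule z12_jump[OF W.vector_space_axioms, symmetric])
      show "(z12_mult ^^ Suc k) (comp12 (Y a) (Y b) v) = (z12_mult ^^ Suc k) (comp21 (Y b) (Y a) v)"
        using assms(2) by (simp add: local_order_def)
      show "comp12 (Y a) (Y b) v e1 p1 e2 p2 = 0" if "Re e2 < B2" for e1 p1 e2 p2
        using B(2)[OF that] by (simp add: comp12_def Y2.zero)
      show "comp21 (Y b) (Y a) v e1 p1 e2 p2 = 0" if "Re e1 < B1" for e1 p1 e2 p2
        using B(1)[OF that] by (simp add: comp21_def Y2.zero)
      show "n \<in> I" if "(z12_mult ^^ Suc k) (comp12 (Y a) (Y b) v) (- m - 1 + 1 + of_int n) 0
          (e + of_nat k - of_int n) p \<noteq> 0" for n
        using that window[OF a, of n 0 p] unfolding cleared_def x_def[symmetric] xs(2) unfolding xs(1) by blast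
    qed (rule I(1))
  qed
  finally show ?thesis by (simp add: c_def comp12_def comp21_def)
qed

lemma Y_ext_monomial:
  assumes "\<And>d q. f d q = (if d = d0 then g q else 0)"
  shows "Y_ext Y f v e p = (\<Sum>q\<le>p. Y (g q) v (e - d0) (p - q))"
  unfolding Y_ext_def
proof (rule sum.cong[OF refl])
  fix q
  have "Sum_any (\<lambda>d. Y (f d q) v (e - d) (p - q)) = Y (f d0 q) v (e - d0) (p - q)"
    by (rule Sum_any_single) (auto simp: assms Y1.zero split: if_splits)
  then show "Sum_any (\<lambda>d. Y (f d q) v (e - d) (p - q)) = Y (g q) v (e - d0) (p - q)"
    by (simp add: assms)
qed

lemma mode_eq: "mode scaleV T Y a r v = Y a v (- r - 1) 0"
proof -
  have "X_field scaleV T Y a v (- r - 1) 0 = (\<Sum>q\<le>0. Y (scaleV (1 / fact q) ((T ^^ q) a)) v (- r - 1 - 0) (0 - q))"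
    unfolding X_field_def by (rule Y_ext_monomial) (simp add: zpow_op_def)
  then show ?thesis by (simp add: mode_def)
qed

text \<open>The \<open>j\<close>-th term of the formula for \<open>[a\<^bsub>(m+T)\<^esub>, Y(b, z)]\<close>; the terms of the other two formulas are
  coefficients of such terms.\<close>

definition commutator_term :: "'v \<Rightarrow> 'v \<Rightarrow> nat \<Rightarrow> 'w logop" where
  "commutator_term a b j = Y_ext Y (prod_ext nprod
     (\<lambda>e p. binom_op scaleV T m j (zpow_op scaleV T (m - of_nat j) a e p)) (int j) b)"

lemma commutator_term_eq:
  "commutator_term a b j v e p = (\<Sum>q\<le>p. Y (nprod (binom_op scaleV T m j (scaleV (1 / fact q) ((T ^^ q) a)))
      (int j) b) v (e - (m - of_nat j)) (p - q))"
  unfolding commutator_term_def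
  by (rule Y_ext_monomial) (simp add: prod_ext_def zpow_op_def nprod_zero)

lemma commutator_term_sum:
  assumes "a \<in> U" "local_order (Suc k) (Y a) (Y b)"
  shows "(\<Sum>j<Suc k. commutator_term a b j v e p)
    = commutator (\<lambda>w. Y a w (- m - 1) 0) (\<lambda>w. Y b w e p) v"
  unfolding commutator_term_eq commutator_def by (rule commutator_coeff[OF assms])

lemma commutator_term_zero:
  assumes "a \<in> U" "local_order K (Y a) (Y b)" "j \<ge> K"
  shows "commutator_term a b j = 0"
proof (intro ext)
  fix v e p
  obtain B where "\<And>e p. Re e < B \<Longrightarrow> Y a v e p = 0" using Y_below by metis
  then have a: "a \<in> admissible K b v B" using assms by (simp add: admissible_def)
  have adm: "binom_op scaleV T m j (scaleV (1 / fact q) ((T ^^ q) a)) \<in> admissible K b v B" for q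
    by (intro V.T_invariant_binom_op V.T_invariant_scale V.T_invariant_pow T_invariant_admissible a)
  then show "commutator_term a b j v e p = 0 v e p"
    unfolding commutator_term_eq zero_fun_apply
    using adm assms(3) by (intro sum.neutral ballI Y_prod_zero) (auto simp: admissible_def)
qed

end

section \<open>Logarithmic fields and the shifted delta function\<close>

lemma
  assumes "a \<in> LFie scale" "vector_space scale"
  shows LFie_linear: "Vector_Spaces.linear scale scale (\<lambda>v. a v e p)"
    and LFie_finite: "finite {p. a v e p \<noteq> 0}"
    and LFie_below: "\<exists>B. \<forall>e p. Re e < B \<longrightarrow> a v e p = 0"
proof -
  obtain A f where A: "finite A" "A \<subseteq> C_mod_Z" and f: "\<And>\<alpha>. \<alpha> \<in> A \<Longrightarrow> f \<alpha> \<in> LFie_comp scale \<alpha>"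
    and a: "a = (\<Sum>\<alpha>\<in>A. f \<alpha>)"
    using assms(1) unfolding LFie_def by blast
  interpret vector_space_pair scale scale
    using assms(2) by (simp add: vector_space_pair_def)
  have a_eq: "a v e p = (\<Sum>\<alpha>\<in>A. f \<alpha> v e p)" for v e p
    by (simp add: a sum_fun_apply)
  show "Vector_Spaces.linear scale scale (\<lambda>v. a v e p)"
    unfolding a_eq using f by (intro linear_compose_sum) (auto simp: LFie_comp_def)
  have "finite {p. f \<alpha> v e p \<noteq> 0}" if "\<alpha> \<in> A" for \<alpha>
    using f[OF that] by (auto simp: LFie_comp_def lser_shift_def)
  then have "finite (\<Union>\<alpha>\<in>A. {p. f \<alpha> v e p \<noteq> 0})" using A(1) by blast
  moreover have "{p. a v e p \<noteq> 0} \<subseteq> (\<Union>\<alpha>\<in>A. {p. f \<alpha> v e p \<noteq> 0})"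
    unfolding a_eq by (auto dest: sum.not_neutral_contains_not_neutral)
  ultimately show "finite {p. a v e p \<noteq> 0}" by (rule rev_finite_subset)
  have "\<exists>B. \<forall>e p. Re e < B \<longrightarrow> f \<alpha> v e p = 0" if "\<alpha> \<in> A" for \<alpha>
  proof -
    have "f \<alpha> v \<in> lser_shift \<alpha>" using f[OF that] by (simp add: LFie_comp_def)
    then obtain m where m: "\<And>e p. f \<alpha> v e p \<noteq> 0 \<Longrightarrow> \<exists>i::nat. e = of_nat i - m"
      unfolding lser_shift_def by blast
    have "f \<alpha> v e p = 0" if "Re e < - Re m" for e p
      using m[of e p] that by force
    then show ?thesis by blast
  qed
  then obtain B where B: "\<And>\<alpha> e p. \<alpha> \<in> A \<Longrightarrow> Re e < B \<alpha> \<Longrightarrow> f \<alpha> v e p = 0"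
    by metis
  define B0 where "B0 = Min (insert 0 (B ` A))"
  have "a v e p = 0" if "Re e < B0" for e p
    unfolding a_eq
  proof (rule sum.neutral, rule ballI)
    fix \<alpha> assume "\<alpha> \<in> A"
    then have "B0 \<le> B \<alpha>" using A(1) by (auto simp: B0_def intro: Min_le)
    then show "f \<alpha> v e p = 0" using that B[OF \<open>\<alpha> \<in> A\<close>] by simp
  qed
  then show "\<exists>B. \<forall>e p. Re e < B \<longrightarrow> a v e p = 0" by blast
qed

lemma C_mod_Z_mem_iff:
  assumes "\<alpha> \<in> C_mod_Z" "m \<in> \<alpha>"
  shows "n \<in> \<alpha> \<longleftrightarrow> (\<exists>k::int. n = m + of_int k)"
proof -
  obtain x where x: "\<alpha> = {y. x - y \<in> \<int>}"
    using assms(1) by (auto simp: C_mod_Z_def quotient_def)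
  have xm: "x - m \<in> \<int>" using assms(2) by (simp add: x)
  have "x - n \<in> \<int> \<longleftrightarrow> n - m \<in> \<int>"
    using Ints_diff[OF xm, of "x - n"] Ints_diff[OF xm, of "n - m"] by auto
  also have "\<dots> \<longleftrightarrow> (\<exists>k::int. n = m + of_int k)"
    by (auto simp: Ints_def algebra_simps)
  finally show ?thesis by (simp add: x)
qed

context vs_operator
begin

lemma zpow_op_support: "zpow_op scale T r a e p \<noteq> 0 \<Longrightarrow> e = r"
  by (simp add: zpow_op_def split: if_splits)

text \<open>\<open>D\<^sub>z z\<^bsup>m+T\<^esup> = (m + T) z\<^bsup>m-1+T\<^esup>\<close>, as for a scalar exponent.\<close>

lemma Dz_div_zpow_op:
  "Dz_div scale j (zpow_op scale T m a)
    = (\<lambda>e p. binom_op scale T m j (zpow_op scale T (m - of_nat j) a e p))"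
proof -
  have "(Dz scale ^^ j) (zpow_op scale T m a) e p
    = zpow_op scale T (m - of_nat j) (falling_op scale T m j a) e p" for e p
  proof (induction j arbitrary: e p)
    case (Suc j)
    define d where "d = falling_op scale T m j a"
    have falling_Suc: "falling_op scale T m (Suc j) a = scale (m - of_nat j) d + T d"
      unfolding d_def by (rule falling_op_Suc_outer)
    have fact_Suc': "of_nat (Suc p) * (1 / fact (Suc p)) = (1 / fact p :: complex)"
      by (simp del: of_nat_Suc)
    have "(Dz scale ^^ Suc j) (zpow_op scale T m a) e p
        = (if e + 1 = m - of_nat j then scale (e + 1) (scale (1 / fact p) ((T ^^ p) d))
            + scale (of_nat (Suc p)) (scale (1 / fact (Suc p)) ((T ^^ Suc p) d)) else 0)"
      unfolding Dz_pow_Suc Suc.IH d_def[symmetric] by (simp add: zpow_op_def del: of_nat_Suc fact_Suc)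
    also have "\<dots> = (if e = m - of_nat (Suc j) then scale (1 / fact p) ((T ^^ p) (scale (m - of_nat j) d + T d)) else 0)"
    proof (cases "e = m - of_nat (Suc j)")
      case True
      then have "e + 1 = m - of_nat j" by simp
      then show ?thesis
        using True unfolding scale_scale fact_Suc'
        by (simp add: T_pow_add T_pow_scale funpow_swap1 scale_right_distrib)
    next
      case False
      then have "e + 1 \<noteq> m - of_nat j" by (auto simp: algebra_simps)
      then show ?thesis using False by simp
    qed
    finally show ?case
      by (simp only: zpow_op_def falling_Suc)
  qed (simp add: zpow_op_def)
  moreover have "falling_op scale T m j ((T ^^ p) a) = (T ^^ p) (falling_op scale T m j a)" for p
    by (induction p) (simp_all add: falling_op_T)
  ultimately show ?thesis
    by (auto simp: Dz_div_def zpow_op_def binom_op_scale fun_eq_iff) (simp add: binom_op_def T_pow_scale mult.commute)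
qed

lemma zpow_op_zero [simp]: "zpow_op scale T m 0 = 0"
  by (simp add: zpow_op_def fun_eq_iff)

text \<open>A coefficient in \<open>z\<^sub>1\<close> and \<open>\<zeta>\<^sub>1\<close> selects the single exponent \<open>m = - e\<^sub>1 - 1\<close>, and the factor \<open>e\<^bsup>-\<zeta>\<^sub>1 T\<^esup>\<close> acts on
  \<open>a\<close> exactly as it does in the coefficient of \<open>Y(a, z\<^sub>1)\<close>.\<close>

lemma delta_op_eq:
  "delta_op scale T \<alpha> a e1 p1 = (if - e1 - 1 \<in> \<alpha>
      then zpow_op scale T (- e1 - 1) (scale ((- 1) ^ p1 / fact p1) ((T ^^ p1) a)) else 0)"
proof (intro ext)
  fix e2 p2
  interpret neg: vs_operator scale "\<lambda>x. - T x" by (rule neg_operator)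
  have "delta_op scale T \<alpha> a e1 p1 e2 p2 = (if - e1 - 1 \<in> \<alpha>
     then zpow_op scale (\<lambda>x. - T x) (- (- e1 - 1) - 1) (zpow_op scale T (- e1 - 1) a e2 p2) e1 p1 else 0)"
    unfolding delta_op_def
    by (rule Sum_any_single) (auto split: if_splits dest: neg.zpow_op_support)
  also have "\<dots> = (if - e1 - 1 \<in> \<alpha>
      then zpow_op scale T (- e1 - 1) (scale ((- 1) ^ p1 / fact p1) ((T ^^ p1) a)) else 0) e2 p2"
  proof -
    have "(T ^^ p1) ((T ^^ p2) a) = (T ^^ p2) ((T ^^ p1) a)"
      by (metis add.commute comp_apply funpow_add)
    then show ?thesis by (simp add: zpow_op_def neg_pow T_pow_scale)
  qed
  finally show "delta_op scale T \<alpha> a e1 p1 e2 p2 = (if - e1 - 1 \<in> \<alpha>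
      then zpow_op scale T (- e1 - 1) (scale ((- 1) ^ p1 / fact p1) ((T ^^ p1) a)) else 0) e2 p2" .
qed

lemma Dz_div_zero: "Dz_div scale j 0 = 0"
  using Dz_div_zpow_op[of j 0 0] by (simp add: fun_eq_iff)

end

section \<open>The commutator formulas\<close>

text \<open>On \<open>U\<close> the automorphism \<open>\<phi>\<close> is \<open>e\<^bsup>-2\<pi>\<i>(m+\<N>)\<^esup>\<close>, so that \<open>Y(\<phi> a, z) = e\<^bsup>2\<pi>\<i>D\<^sub>\<zeta>\<^esup> Y(a, z)\<close> is, in the coefficient of \<open>z\<^sup>e\<close>,
  the monodromy equation with \<open>\<tau> = 2\<pi>\<i>\<close> and \<open>c = e\<^bsup>2\<pi>\<i>(e+m)\<^esup>\<close>.\<close>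

lemma twisted_log_component:
  fixes scaleV :: "complex \<Rightarrow> 'v::ab_group_add \<Rightarrow> 'v"
    and scaleW :: "complex \<Rightarrow> 'w::ab_group_add \<Rightarrow> 'w"
    and Y :: "'v \<Rightarrow> 'w logop"
  assumes va: "vertex_algebra scaleV vac nprod"
    and \<sigma>: "\<sigma> \<in> va_Aut scaleV nprod"
    and \<N>: "\<N> \<in> va_Der scaleV nprod" "locally_nilpotent \<N>"
    and comm: "\<sigma> \<circ> \<N> = \<N> \<circ> \<sigma>"
    and \<phi>: "\<phi> = \<sigma> \<circ> exp_op scaleV (- 2 * of_real pi * \<i>) \<N>"
    and tw: "twisted_module scaleV vac nprod \<phi> scaleW Y"
    and m: "m \<in> \<alpha>"
  shows "\<alpha> \<in> C_mod_Z \<Longrightarrow>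
    log_component scaleV \<N> scaleW nprod Y (sigma_eigenspace scaleV \<sigma> \<alpha>) m"
proof -
  assume \<alpha>: "\<alpha> \<in> C_mod_Z"
  interpret vertex_algebra scaleV vac nprod by fact
  interpret V: vs_operator scaleV \<N>
    using \<N>(1) by unfold_locales (simp_all add: va_Der_def Vector_Spaces.linear_iff)
  interpret W: vector_space scaleW using tw by (simp add: twisted_module_def)
  have Y_linear: "Vector_Spaces.linear scaleV scaleW (\<lambda>a. Y a v e p)" for v e p
    using tw by (simp add: twisted_module_def)
  have Y_LFie: "Y a \<in> LFie scaleW" for a using tw by (simp add: twisted_module_def)
  interpret Y: Vector_Spaces.linear scaleV scaleW "\<lambda>a. Y a v e p" for v e p by (rule Y_linear)
  define U where "U = sigma_eigenspace scaleV \<sigma> \<alpha>"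
  interpret \<sigma>: Vector_Spaces.linear scaleV scaleV \<sigma> using \<sigma> by (simp add: va_Aut_def)
  have \<sigma>\<N>: "\<sigma> (\<N> x) = \<N> (\<sigma> x)" for x using comm by (simp add: fun_eq_iff)
  have U: "V.T_invariant U"
    unfolding V.T_invariant_def U_def sigma_eigenspace_def
    by (auto simp: \<sigma>.add \<sigma>.scale scale_right_distrib \<sigma>\<N> V.T_scale mult.commute)
  have U_sum: "sum f A \<in> U" if "finite A" "\<And>i. i \<in> A \<Longrightarrow> f i \<in> U" for f and A :: "nat set"
  proof -
    have zero: "0 \<in> U" by (simp add: U_def sigma_eigenspace_def \<sigma>.zero)
    from that show ?thesis
      by (induction A rule: finite_induct) (auto intro: V.T_invariant_add[OF U] zero)
  qed
  define \<tau> :: complex where "\<tau> = 2 * of_real pi * \<i>"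
  have \<tau>: "\<tau> \<noteq> 0" "- 2 * of_real pi * \<i> = - \<tau>" by (simp_all add: \<tau>_def)
  have quasi: "Y (exp_op scaleV (- \<tau>) \<N> x) v e p = scaleW (exp (\<tau> * (e + m)))
      (Sum_any (\<lambda>q. scaleW (of_nat (q choose p) * \<tau> ^ (q - p)) (Y x v e q)))"
    if "x \<in> U" for x v e p
  proof -
    define z where "z = exp_op scaleV (- \<tau>) \<N> x"
    obtain K where "(\<N> ^^ K) x = 0" using \<N>(2) unfolding locally_nilpotent_def by blast
    then have "z = (\<Sum>k<K. scaleV ((- \<tau>) ^ k / fact k) ((\<N> ^^ k) x))"
      unfolding z_def by (rule V.exp_op_eq_sum)
    then have "z \<in> U"
      using that by (auto intro!: U_sum V.T_invariant_scale[OF U] V.T_invariant_pow[OF U])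
    then have "\<sigma> z = scaleV (exp (- \<tau> * m)) z"
      using m unfolding U_def sigma_eigenspace_def \<tau>(2) by blast
    then have "scaleW (exp (- \<tau> * m)) (Y z v e p) = Y (\<phi> x) v e p"
      by (simp only: \<phi> comp_apply \<tau>(2) z_def[symmetric]) (simp only: Y.scale)
    also have "\<dots> = monodromy scaleW (Y x v) e p"
      using tw by (simp add: twisted_module_def)
    finally have "scaleW (exp (\<tau> * m)) (scaleW (exp (- \<tau> * m)) (Y z v e p))
        = scaleW (exp (\<tau> * m)) (monodromy scaleW (Y x v) e p)"
      by (simp only:)
    moreover have "exp (\<tau> * m) * exp (- \<tau> * m) = 1" by (simp flip: exp_add)
    moreover have "exp (\<tau> * m) * exp (\<tau> * e) = exp (\<tau> * (e + m))"
      by (simp add: exp_add[symmetric] algebra_simps)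
    ultimately show ?thesis
      by (simp add: z_def monodromy_def \<tau>_def[symmetric])
  qed
  have rigid: "Y x v e p = (if exp (\<tau> * (e + m)) = 1 then scaleW ((- 1) ^ p / fact p) (Y ((\<N> ^^ p) x) v e 0) else 0)"
    if "x \<in> U" for x v e p
  proof -
    obtain K where "(\<N> ^^ K) x = 0" using \<N>(2) unfolding locally_nilpotent_def by blast
    then show ?thesis
    proof (rule V.monodromy_rigidity[where y = "\<lambda>x. Y x v e" and \<tau> = \<tau>, rotated -1])
      show "finite {p. Y x v e p \<noteq> 0}" for x by (rule LFie_finite[OF Y_LFie W.vector_space_axioms])
    qed (use that in \<open>simp_all add: Y_linear \<tau>(1) quasi V.T_invariant_pow[OF U]\<close>)
  qed
  have "log_component scaleV \<N> scaleW nprod Y U m"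
  proof unfold_locales
    show "V.T_invariant U" by (rule U)
    show "\<exists>B. \<forall>e p. Re e < B \<longrightarrow> Y a v e p = 0" for a v by (rule LFie_below[OF Y_LFie W.vector_space_axioms])
    show "local_pair (Y a) (Y b)" for a b
      using tw by (simp add: twisted_module_def local_collection_def)
    show "Y (nprod a n b) = nth_prod scaleW (Y a) n (Y b)" for a n b
      using tw by (simp add: twisted_module_def)
    show "nprod 0 n b = 0" for n b
      using module_hom.zero[OF prod_linear_left[of n b, unfolded linear_iff_module_hom]] .
    show "Y (\<N> x) v e p = scaleW (- of_nat (Suc p)) (Y x v e (Suc p))" if "x \<in> U" for x v e p
    proof -
      have "- of_nat (Suc p) * ((- 1) ^ Suc p / fact (Suc p)) = ((- 1) ^ p / fact p :: complex)"
        by (simp add: divide_simps del: of_nat_Suc)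
      then show ?thesis
        unfolding rigid[OF that, of v e "Suc p"] rigid[OF V.T_invariant_T[OF U that], of v e p]
        by (simp add: funpow_swap1 del: of_nat_Suc fact_Suc)
    qed
    show "\<exists>n::int. e = of_int n - m" if "x \<in> U" "Y x v e p \<noteq> 0" for x v e p
    proof -
      have "exp (\<tau> * (e + m)) = 1" using rigid[OF that(1), of v e p] that(2) by (auto split: if_splits)
      then obtain n :: int where "e + m = of_int n" unfolding \<tau>_def exp_2pi_eq_1_iff by blast
      then have "e = of_int n - m" by (simp add: algebra_simps)
      then show ?thesis ..
    qed
  qed (use Y_linear LFie_linear[OF Y_LFie W.vector_space_axioms] in \<open>simp_all add: Vector_Spaces.linear_iff\<close>)
  then show ?thesis by (simp add: U_def)
qed

context log_component
begin

lemma field_commutator_mode: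
  assumes a: "a \<in> U"
  shows "has_finite_sum
    (\<lambda>j. Y_ext Y (prod_ext nprod
       (\<lambda>e p. binom_op scaleV T m j (zpow_op scaleV T (m - of_nat j) a e p)) (int j) b))
    (\<lambda>v e p. commutator (mode scaleV T Y a m) (\<lambda>w. Y b w e p) v)"
proof -
  obtain k where k: "local_order (Suc k) (Y a) (Y b)" by (rule Y_local_Suc)
  show ?thesis
    unfolding commutator_term_def[symmetric]
  proof (rule has_finite_sum_lessThan)
    show "commutator_term a b j = 0" if "j \<ge> Suc k" for j
      using a k that by (rule commutator_term_zero)
    show "(\<Sum>j<Suc k. commutator_term a b j)
        = (\<lambda>v e p. commutator (mode scaleV T Y a m) (\<lambda>w. Y b w e p) v)"
      by (intro ext) (simp only: sum_fun_apply commutator_term_sum[OF a k] mode_eq[abs_def])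
  qed
qed

text \<open>The coefficient of \<open>z\<^bsup>-r-1\<^esup> \<zeta>\<^sup>0\<close> in the formula for \<open>[a\<^bsub>(m+T)\<^esub>, Y(b, z)]\<close>.\<close>

lemma mode_commutator_mode:
  assumes a: "a \<in> U"
  shows "has_finite_sum
    (\<lambda>j. mode scaleV T Y (nprod (binom_op scaleV T m j a) (int j) b) (m + r - of_nat j))
    (commutator (mode scaleV T Y a m) (mode scaleV T Y b r))"
proof -
  obtain k where k: "local_order (Suc k) (Y a) (Y b)" by (rule Y_local_Suc)
  have mode_term: "mode scaleV T Y (nprod (binom_op scaleV T m j a) (int j) b) (m + r - of_nat j) v
      = commutator_term a b j v (- r - 1) 0" for j v
    by (simp add: mode_eq commutator_term_eq algebra_simps)
  show ?thesis
  proof (rule has_finite_sum_lessThan)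
    show "mode scaleV T Y (nprod (binom_op scaleV T m j a) (int j) b) (m + r - of_nat j) = 0"
      if "j \<ge> Suc k" for j
      by (intro ext) (simp add: mode_term commutator_term_zero[OF a k that])
    show "(\<Sum>j<Suc k. mode scaleV T Y (nprod (binom_op scaleV T m j a) (int j) b) (m + r - of_nat j))
        = commutator (mode scaleV T Y a m) (mode scaleV T Y b r)"
      by (intro ext)
        (simp only: sum_fun_apply mode_term commutator_term_sum[OF a k], simp only: mode_eq[abs_def])
  qed
qed

lemma delta_term:
  assumes "- e1 - 1 = m" "m \<in> \<alpha>"
  shows "Y_ext Y (prod_ext nprod (Dz2_div scaleV j (delta_op scaleV T \<alpha> a) e1 p1) (int j) b)
    = commutator_term (scaleV ((- 1) ^ p1 / fact p1) ((T ^^ p1) a)) b j"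
  using assms by (simp add: Dz2_div_def V.delta_op_eq V.Dz_div_zpow_op commutator_term_def)

lemma log_coeff_admissible:
  assumes "a \<in> U" "local_order K (Y a) (Y b)"
  shows "scaleV r ((T ^^ p) a) \<in> U" "local_order K (Y (scaleV r ((T ^^ p) a))) (Y b)"
proof -
  fix v
  obtain B where "\<And>e p. Re e < B \<Longrightarrow> Y a v e p = 0" using Y_below by metis
  then have "a \<in> admissible K b v B" using assms by (simp add: admissible_def)
  then have "scaleV r ((T ^^ p) a) \<in> admissible K b v B"
    by (intro V.T_invariant_scale V.T_invariant_pow T_invariant_admissible)
  then show "scaleV r ((T ^^ p) a) \<in> U" "local_order K (Y (scaleV r ((T ^^ p) a))) (Y b)"
    by (simp_all add: admissible_def)
qed

end

text \<open>The coefficient of \<open>z\<^sub>1\<^bsup>-m-1\<^esup> \<zeta>\<^sub>1\<^sup>p\<close> on both sides is the formula for \<open>[a'\<^bsub>(m+T)\<^esub>, Y(b, z\<^sub>2)]\<close> with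
  \<open>a' = (-T)\<^bsup>p\<^esup> a / p!\<close>. The exponent \<open>m\<close> varies over the whole class \<open>\<alpha>\<close>, while the order of locality, which
  bounds the number of terms, can be chosen once.\<close>

lemma field_commutator_field:
  fixes Y :: "'v::ab_group_add \<Rightarrow> 'w::ab_group_add logop"
  assumes component: "\<And>m. m \<in> \<alpha> \<Longrightarrow> log_component scaleV T scaleW nprod Y U m"
    and \<alpha>: "\<alpha> \<in> C_mod_Z" and a: "a \<in> U"
  shows "has_finite_sum
    (\<lambda>j v e1 p1. Y_ext Y
       (prod_ext nprod (Dz2_div scaleV j (delta_op scaleV T \<alpha> a) e1 p1) (int j) b) v)
    (\<lambda>v e1 p1 e2 p2. commutator (\<lambda>w. Y a w e1 p1) (\<lambda>w. Y b w e2 p2) v)"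
proof -
  obtain m0 where "\<alpha> = {y. m0 - y \<in> \<int>}"
    using \<alpha> by (auto simp: C_mod_Z_def quotient_def)
  then have m0: "m0 \<in> \<alpha>" by simp
  interpret base: log_component scaleV T scaleW nprod Y U m0 by (rule component) (rule m0)
  obtain k where k: "local_order (Suc k) (Y a) (Y b)" by (rule base.Y_local_Suc)
  define t where "t j v e1 p1 = Y_ext Y
    (prod_ext nprod (Dz2_div scaleV j (delta_op scaleV T \<alpha> a) e1 p1) (int j) b) v" for j v e1 p1
  have t: "(j \<ge> Suc k \<longrightarrow> t j v e1 p1 e2 p2 = 0)
      \<and> (\<Sum>j<Suc k. t j v e1 p1 e2 p2) = commutator (\<lambda>w. Y a w e1 p1) (\<lambda>w. Y b w e2 p2) v"
    for j v e1 p1 e2 p2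
  proof (cases "- e1 - 1 \<in> \<alpha>")
    case True
    define m where "m = - e1 - 1"
    have m: "m \<in> \<alpha>" and e1: "e1 = - m - 1" using True by (simp_all add: m_def)
    interpret log_component scaleV T scaleW nprod Y U m by (rule component) (rule m)
    define a' where "a' = scaleV ((- 1) ^ p1 / fact p1) ((T ^^ p1) a)"
    have a': "a' \<in> U" "local_order (Suc k) (Y a') (Y b)"
      unfolding a'_def by (rule log_coeff_admissible[OF a k])+
    have "t j v e1 p1 e2 p2 = commutator_term a' b j v e2 p2" for j
      unfolding t_def a'_def by (subst delta_term) (use m in \<open>simp_all add: m_def\<close>)
    moreover have "Y a w e1 p1 = Y a' w (- m - 1) 0" for w
      using Y_log_coeff[OF a, of w e1 p1] by (simp add: a'_def e1 base.Y1.scale)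
    ultimately show ?thesis
      using commutator_term_zero[OF a'] commutator_term_sum[OF a'] by simp
  next
    case False
    have "Y a w e1 p1 = 0" for w
    proof (rule ccontr)
      assume "Y a w e1 p1 \<noteq> 0"
      then obtain n :: int where "e1 = of_int n - m0" using base.Y_coset[OF a] by blast
      then have "- e1 - 1 = m0 + of_int (- n - 1)" by simp
      then show False using False C_mod_Z_mem_iff[OF \<alpha> m0] by blast
    qed
    moreover have "t j v e1 p1 e2 p2 = 0" for j
    proof -
      have "Dz2_div scaleV j (delta_op scaleV T \<alpha> a) e1 p1 = 0"
        unfolding Dz2_div_def base.V.delta_op_eq using False base.V.Dz_div_zero by simp
      then show ?thesis
        by (simp add: t_def prod_ext_def Y_ext_def base.nprod_zero base.Y1.zero)
    qed
    ultimately show ?thesis by (simp add: commutator_def base.Y2.zero)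
  qed
  show ?thesis
    unfolding t_def[symmetric]
  proof (rule has_finite_sum_lessThan)
    show "(\<lambda>v e1 p1. t j v e1 p1) = 0" if "j \<ge> Suc k" for j
      by (intro ext) (use t that in simp)
    show "(\<Sum>j<Suc k. (\<lambda>v e1 p1. t j v e1 p1))
        = (\<lambda>v e1 p1 e2 p2. commutator (\<lambda>w. Y a w e1 p1) (\<lambda>w. Y b w e2 p2) v)"
      by (intro ext) (simp only: sum_fun_apply t)
  qed
qed

theorem mainTheorem2:
  fixes scaleV :: "complex \<Rightarrow> 'v::ab_group_add \<Rightarrow> 'v"
    and vac :: 'v
    and nprod :: "'v \<Rightarrow> int \<Rightarrow> 'v \<Rightarrow> 'v"
    and \<phi> \<sigma> \<N> :: "'v \<Rightarrow> 'v"
    and scaleW :: "complex \<Rightarrow> 'w::ab_group_add \<Rightarrow> 'w"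
    and Y :: "'v \<Rightarrow> 'w logop"
  assumes "vertex_algebra scaleV vac nprod"
    and "\<phi> \<in> va_Aut scaleV nprod" and "locally_finite_op scaleV \<phi>"
    and "\<sigma> \<in> va_Aut scaleV nprod" and "semisimple_op scaleV \<sigma>"
    and "\<N> \<in> va_Der scaleV nprod" and "locally_nilpotent \<N>"
    and "\<sigma> \<circ> \<N> = \<N> \<circ> \<sigma>"
    and "\<phi> = \<sigma> \<circ> exp_op scaleV (- 2 * of_real pi * \<i>) \<N>"
    and "twisted_module scaleV vac nprod \<phi> scaleW Y"
  shows "(\<forall>\<alpha>\<in>C_mod_Z. \<forall>\<beta>\<in>C_mod_Z. \<forall>a\<in>sigma_eigenspace scaleV \<sigma> \<alpha>.
      \<forall>b\<in>sigma_eigenspace scaleV \<sigma> \<beta>. \<forall>m\<in>\<alpha>. \<forall>k\<in>\<beta>.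
      has_finite_sum
        (\<lambda>j. mode scaleV \<N> Y (nprod (binom_op scaleV \<N> m j a) (int j) b) (m + k - of_nat j))
        (commutator (mode scaleV \<N> Y a m) (mode scaleV \<N> Y b k)))
    \<and> (\<forall>\<alpha>\<in>C_mod_Z. \<forall>a\<in>sigma_eigenspace scaleV \<sigma> \<alpha>. \<forall>b.
      has_finite_sum
        (\<lambda>j v e1 p1. Y_ext Y
           (prod_ext nprod (Dz2_div scaleV j (delta_op scaleV \<N> \<alpha> a) e1 p1) (int j) b) v)
        (\<lambda>v e1 p1 e2 p2. commutator (\<lambda>w. Y a w e1 p1) (\<lambda>w. Y b w e2 p2) v))
    \<and> (\<forall>\<alpha>\<in>C_mod_Z. \<forall>a\<in>sigma_eigenspace scaleV \<sigma> \<alpha>. \<forall>m\<in>\<alpha>. \<forall>b.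
      has_finite_sum
        (\<lambda>j. Y_ext Y (prod_ext nprod
           (\<lambda>e p. binom_op scaleV \<N> m j (zpow_op scaleV \<N> (m - of_nat j) a e p)) (int j) b))
        (\<lambda>v e p. commutator (mode scaleV \<N> Y a m) (\<lambda>w. Y b w e p) v))"
proof (intro conjI ballI allI)
  note component = twisted_log_component[OF assms(1,4,6-10)]
  show "has_finite_sum
      (\<lambda>j. mode scaleV \<N> Y (nprod (binom_op scaleV \<N> m j a) (int j) b) (m + k - of_nat j))
      (commutator (mode scaleV \<N> Y a m) (mode scaleV \<N> Y b k))"
    if "\<alpha> \<in> C_mod_Z" "m \<in> \<alpha>" "a \<in> sigma_eigenspace scaleV \<sigma> \<alpha>" for \<alpha> a b m k
    by (rule log_component.mode_commutator_mode[OF component that(3)]) (rule that)+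
  show "has_finite_sum
      (\<lambda>j v e1 p1. Y_ext Y
         (prod_ext nprod (Dz2_div scaleV j (delta_op scaleV \<N> \<alpha> a) e1 p1) (int j) b) v)
      (\<lambda>v e1 p1 e2 p2. commutator (\<lambda>w. Y a w e1 p1) (\<lambda>w. Y b w e2 p2) v)"
    if "\<alpha> \<in> C_mod_Z" "a \<in> sigma_eigenspace scaleV \<sigma> \<alpha>" for \<alpha> a b
    by (rule field_commutator_field[OF component]) (use that in auto)
  show "has_finite_sum
      (\<lambda>j. Y_ext Y (prod_ext nprod
         (\<lambda>e p. binom_op scaleV \<N> m j (zpow_op scaleV \<N> (m - of_nat j) a e p)) (int j) b))
      (\<lambda>v e p. commutator (mode scaleV \<N> Y a m) (\<lambda>w. Y b w e p) v)"
    if "\<alpha> \<in> C_mod_Z" "m \<in> \<alpha>" "a \<in> sigma_eigenspace scaleV \<sigma> \<alpha>" for \<alpha> a m b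
    by (rule log_component.field_commutator_mode[OF component that(3)]) (rule that)+
qed

end
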